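(* Let $\mathcal{K}$ be a continuous kernel on the compact set $\mathcal{Z}$, let $\mathrm{IPM}_{\mathcal{F}}=\mathrm{MMD}_{\mathcal{K}}$, and let $\rho$ be strictly convex and continuous on $[0,W]$, differentiable on $(0,W)$, with $\rho(x)=+\infty$ outside $[0,W]$. Let $\lambda\ge0$ and let $$\mathbf{w}=\operatorname*{arg\,min}_{\mathbf{w}'\in\Lambda_n;\ w_i'\le W/n\ \forall i}\ \mathrm{MMD}^2_{\mathcal{K}}\big(\hat P^{\mathbf{w}'}_{T,X},\hat Q_{T,X}\big)+\lambda R_n(\mathbf{w}'),\qquad R_n(\mathbf{w}')=n^{-2}\sum_{i=1}^n\rho(nw_i').$$ A dual problem of this optimization problem is $$\min_{\mu,\boldsymbol\alpha}\ \frac1n\sum_{i=1}^n\rho^*\big(-\mu-\boldsymbol\alpha^T\mathbf{k}(Z_i)\big)+\mu+\frac{\lambda}{4n}\boldsymbol\alpha^T\mathbf{K}\boldsymbol\alpha+\boldsymbol\alpha^T\mathbb{E}_{\hat Q_{T,X}}[\mathbf{k}(Z)],$$ over $\mu\in\mathbb{R}$ and $\boldsymbol\alpha=(\alpha(z))_{z\in\hat{\mathcal{Z}}}\in\mathbb{R}^{\hat{\mathcal{Z}}}$, where $\mathbf{k}(\cdot)=(\mathcal{K}(z,\cdot))_{z\in\hat{\mathcal{Z}}}$, $\mathbf{K}=(\mathcal{K}(z,z'))_{z,z'\in\hat{\mathcal{Z}}}$ and $\hat{\mathcal{Z}}=\mathrm{supp}(\hat P^n_Z)\cup\mathrm{supp}(\hat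 Q_{T,X})$. If $\mu^0$ and $\boldsymbol\alpha^0$ are solutions of this dual problem, then for all $i$ $$nw_i=\frac{d\rho^*}{dx}\big(-\mu^0-(\boldsymbol\alpha^0)^T\mathbf{k}(Z_i)\big).$$
   Context: Data: $Z_i=(T_i,X_i)$, $i=1,\dots,n$, with values in the compact set $\mathcal{Z}\subset\mathbb{R}^{d_T}\times\mathbb{R}^{d_X}$; $W\ge0$ is a clipping constant. $\Lambda_n=\{\mathbf{w}\in\mathbb{R}^n:\mathbf{w}\ge0,\sum_iw_i=1\}$. $\hat P^{\mathbf{w}}_{T,X}=\sum_iw_i\delta_{Z_i}$, $\hat P^n_Z=\frac1n\sum_i\delta_{Z_i}$. $\hat Q_{T,X}$ is a finitely supported probability measure on $\mathcal{Z}$ built from the data (an empirical approximation of $P_T\otimes P_X$). $\mathrm{MMD}_{\mathcal{K}}(P_0,Q_0)=\sup_{f}|\mathbb{E}_{P_0}[f(Z)]-\mathbb{E}_{Q_0}[f(Z)]|$, the supremum over the unit ball of the reproducing kernel Hilbert space (RKHS) of $\mathcal{K}$. $\rho^*(x)=\sup_y\,(yx-\rho(y))$ is the Legendre transform of $\rho$. "Dual problem" is meant in the sense of convex (Fenchel--Rockafellar) duality, the primal objective being normalized by division by $\lambda/n$: for $\lambda>0$ the optimal value of the primal problem equals $-\frac{\lambda}{n}$ times the optimal value of the dual problem.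
   Formalization: For λ=0 the minimizer w is assumed unique: otherwise "the argmin" is not well defined and the formula fails (all Z_i equal, Q̂ a point mass there: every feasible w is optimal, but the formula yields uniform weights). Duality itself is stated for λ>0. *)

theory Defs
  imports "HOL-Probability.Probability"
begin

section \<open>Reproducing kernel Hilbert spaces and maximum mean discrepancy\<close>

definition kernel_on :: "'z set \<Rightarrow> ('z \<Rightarrow> 'z \<Rightarrow> real) \<Rightarrow> bool" where
  "kernel_on Z k \<longleftrightarrow>
     (\<forall>x\<in>Z. \<forall>y\<in>Z. k x y = k y x) \<and>
     (\<forall>S c. finite S \<and> S \<subseteq> Z \<longrightarrow> 0 \<le> (\<Sum>x\<in>S. \<Sum>y\<in>S. c x * c y * k x y))"

definition kernel_section :: "'z set \<Rightarrow> ('z \<Rightarrow> 'z \<Rightarrow> real) \<Rightarrow> 'z \<Rightarrow> 'z \<Rightarrow> real" where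
  "kernel_section Z k z = (\<lambda>x. if x \<in> Z then k z x else 0)"

text \<open>
  A real-valued function on \<open>Z\<close> is represented by the total function that extends it by zero.
  The space is given by its set \<open>H\<close> of functions and its inner product \<open>ip\<close>
  (whose values off \<open>H \<times> H\<close> are irrelevant).  The four groups of conjuncts say that
  \<open>H\<close> is a linear space of functions on \<open>Z\<close>, that \<open>ip\<close> is an inner product on it,
  that the induced norm is complete, and that \<open>k\<close> reproduces.  By the
  Moore--Aronszajn theorem exactly one such space belongs to each kernel.
\<close>

definition is_rkhs ::
  "'z set \<Rightarrow> ('z \<Rightarrow> 'z \<Rightarrow> real) \<Rightarrow> ('z \<Rightarrow> real) set \<Rightarrow> (('z \<Rightarrow> real) \<Rightarrow> ('z \<Rightarrow> real) \<Rightarrow> real) \<Rightarrow> bool" where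
  "is_rkhs Z k H ip \<longleftrightarrow>
     ((\<forall>f\<in>H. \<forall>x. x \<notin> Z \<longrightarrow> f x = 0) \<and>
      (\<lambda>_. 0) \<in> H \<and>
      (\<forall>f\<in>H. \<forall>g\<in>H. (\<lambda>x. f x + g x) \<in> H) \<and>
      (\<forall>f\<in>H. \<forall>c. (\<lambda>x. c * f x) \<in> H)) \<and>
     ((\<forall>f\<in>H. \<forall>g\<in>H. ip f g = ip g f) \<and>
      (\<forall>f\<in>H. \<forall>g\<in>H. \<forall>h\<in>H. ip (\<lambda>x. f x + g x) h = ip f h + ip g h) \<and>
      (\<forall>f\<in>H. \<forall>g\<in>H. \<forall>c. ip (\<lambda>x. c * f x) g = c * ip f g) \<and>
      (\<forall>f\<in>H. 0 \<le> ip f f \<and> (ip f f = 0 \<longrightarrow> f = (\<lambda>_. 0)))) \<and>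
     (\<forall>s :: nat \<Rightarrow> 'z \<Rightarrow> real.
        (\<forall>n. s n \<in> H) \<and>
        (\<forall>e>0. \<exists>N. \<forall>m\<ge>N. \<forall>n\<ge>N.
            sqrt (ip (\<lambda>x. s m x - s n x) (\<lambda>x. s m x - s n x)) < e) \<longrightarrow>
        (\<exists>f\<in>H. (\<lambda>n. sqrt (ip (\<lambda>x. s n x - f x) (\<lambda>x. s n x - f x))) \<longlonglongrightarrow> 0)) \<and>
     (\<forall>z\<in>Z. kernel_section Z k z \<in> H \<and> (\<forall>f\<in>H. ip f (kernel_section Z k z) = f z))"

text \<open>
  The supremum below is over a nonempty set, which is bounded for finitely supported
  distributions on the domain of the kernel.
\<close>

definition mmd ::
  "('z \<Rightarrow> real) set \<Rightarrow> (('z \<Rightarrow> real) \<Rightarrow> ('z \<Rightarrow> real) \<Rightarrow> real) \<Rightarrow> 'z pmf \<Rightarrow> 'z pmf \<Rightarrow> real" where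
  "mmd H ip P Q =
     (SUP f\<in>{f \<in> H. sqrt (ip f f) \<le> 1}.
        \<bar>measure_pmf.expectation P f - measure_pmf.expectation Q f\<bar>)"


section \<open>Convex analysis\<close>

definition strictly_convex_on :: "real set \<Rightarrow> (real \<Rightarrow> ereal) \<Rightarrow> bool" where
  "strictly_convex_on S f \<longleftrightarrow> convex S \<and>
     (\<forall>x\<in>S. \<forall>y\<in>S. \<forall>t\<in>{0<..<1}. x \<noteq> y \<longrightarrow>
        f ((1 - t) * x + t * y) < ereal (1 - t) * f x + ereal t * f y)"

definition conjugate :: "('x \<Rightarrow> 'y \<Rightarrow> real) \<Rightarrow> ('x \<Rightarrow> ereal) \<Rightarrow> 'y \<Rightarrow> ereal" where
  "conjugate pair f y = (SUP x. ereal (pair x y) - f x)"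

definition legendre :: "(real \<Rightarrow> ereal) \<Rightarrow> real \<Rightarrow> ereal" where
  "legendre = conjugate (*)"

text \<open>
  The argument \<open>comb\<close> is the operation \<open>comb t x y = (1 - t) x + t y\<close> of the space;
  it is a parameter since function types carry no vector space structure.
\<close>

definition proper_convex :: "(real \<Rightarrow> 'x \<Rightarrow> 'x \<Rightarrow> 'x) \<Rightarrow> ('x \<Rightarrow> ereal) \<Rightarrow> bool" where
  "proper_convex comb f \<longleftrightarrow>
     (\<forall>x. f x \<noteq> -\<infinity>) \<and> (\<exists>x. f x \<noteq> \<infinity>) \<and>
     (\<forall>x y. \<forall>t\<in>{0<..<1}. f (comb t x y) \<le> ereal (1 - t) * f x + ereal t * f y)"

text \<open>
  The space of real numbers times real vectors indexed by the finite set \<open>S\<close>.  Vectors are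
  total functions, of which the pairing sees only the values on \<open>S\<close>.
\<close>

definition pairing :: "'z set \<Rightarrow> real \<times> ('z \<Rightarrow> real) \<Rightarrow> real \<times> ('z \<Rightarrow> real) \<Rightarrow> real" where
  "pairing S u y = fst u * fst y + (\<Sum>z\<in>S. snd u z * snd y z)"

definition comb_pair ::
  "real \<Rightarrow> real \<times> ('z \<Rightarrow> real) \<Rightarrow> real \<times> ('z \<Rightarrow> real) \<Rightarrow> real \<times> ('z \<Rightarrow> real)" where
  "comb_pair t u v = ((1 - t) * fst u + t * fst v, \<lambda>z. (1 - t) * snd u z + t * snd v z)"

text \<open>
  The primal problem \<open>inf\<^sub>x f x + g (A x)\<close> has the Fenchel--Rockafellar dual
  \<open>sup\<^sub>y - f\<^sup>* (- A\<^sup>T y) - g\<^sup>* y\<close>; \<open>D\<close> is the negative of the dual objective, to be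
  minimized.  \<open>B\<close> is the adjoint of \<open>A\<close>, whose existence makes \<open>A\<close> linear.
\<close>

definition fenchel_rockafellar_dual ::
  "'z set \<Rightarrow> (real ^ 'n \<Rightarrow> ereal) \<Rightarrow> (real \<times> ('z \<Rightarrow> real) \<Rightarrow> ereal) \<Rightarrow> bool" where
  "fenchel_rockafellar_dual S P D \<longleftrightarrow>
     (\<exists>f g A B.
        proper_convex (\<lambda>t x y. (1 - t) *\<^sub>R x + t *\<^sub>R y) f \<and>
        proper_convex comb_pair g \<and>
        (\<forall>x y. pairing S (A x) y = x \<bullet> B y) \<and>
        (\<forall>x. P x = f x + g (A x)) \<and>
        (\<forall>y. D y = conjugate (\<bullet>) f (- B y) + conjugate (pairing S) g y))"


section \<open>The weighting problem and its dual\<close>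

definition feasible_weights :: "real \<Rightarrow> (real ^ 'n) set" where
  "feasible_weights W =
     {w. (\<forall>i. 0 \<le> w $ i) \<and> (\<Sum>i\<in>UNIV. w $ i) = 1 \<and> (\<forall>i. w $ i \<le> W / real CARD('n))}"

text \<open>Meaningful for weights in the probability simplex only.\<close>

definition weighted_dist :: "('n::finite \<Rightarrow> 'z) \<Rightarrow> real ^ 'n \<Rightarrow> 'z pmf" where
  "weighted_dist data w = map_pmf data (embed_pmf (\<lambda>i. w $ i))"

definition empirical_dist :: "('n::finite \<Rightarrow> 'z) \<Rightarrow> 'z pmf" where
  "empirical_dist data = map_pmf data (pmf_of_set UNIV)"

definition R_n :: "(real \<Rightarrow> ereal) \<Rightarrow> real ^ 'n \<Rightarrow> ereal" where
  "R_n \<rho> w = ereal (1 / (real CARD('n))\<^sup>2) * (\<Sum>i\<in>UNIV. \<rho> (real CARD('n) * w $ i))"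

definition primal_objective ::
  "('z \<Rightarrow> real) set \<Rightarrow> (('z \<Rightarrow> real) \<Rightarrow> ('z \<Rightarrow> real) \<Rightarrow> real) \<Rightarrow> (real \<Rightarrow> ereal) \<Rightarrow> real \<Rightarrow>
   ('n::finite \<Rightarrow> 'z) \<Rightarrow> 'z pmf \<Rightarrow> real ^ 'n \<Rightarrow> ereal" where
  "primal_objective H ip \<rho> lam data Q w =
     ereal ((mmd H ip (weighted_dist data w) Q)\<^sup>2) + ereal lam * R_n \<rho> w"

definition normalized_primal ::
  "('z \<Rightarrow> real) set \<Rightarrow> (('z \<Rightarrow> real) \<Rightarrow> ('z \<Rightarrow> real) \<Rightarrow> real) \<Rightarrow> (real \<Rightarrow> ereal) \<Rightarrow> real \<Rightarrow> real \<Rightarrow>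
   ('n::finite \<Rightarrow> 'z) \<Rightarrow> 'z pmf \<Rightarrow> real ^ 'n \<Rightarrow> ereal" where
  "normalized_primal H ip \<rho> W lam data Q w =
     (if w \<in> feasible_weights W
      then primal_objective H ip \<rho> lam data Q w / ereal (lam / real CARD('n)) else \<infinity>)"

definition support_points :: "('n::finite \<Rightarrow> 'z) \<Rightarrow> 'z pmf \<Rightarrow> 'z set" where
  "support_points data Q = set_pmf (empirical_dist data) \<union> set_pmf Q"

definition dual_argument ::
  "('z \<Rightarrow> 'z \<Rightarrow> real) \<Rightarrow> ('n::finite \<Rightarrow> 'z) \<Rightarrow> 'z pmf \<Rightarrow> real \<Rightarrow> ('z \<Rightarrow> real) \<Rightarrow> 'n \<Rightarrow> real" where
  "dual_argument k data Q \<mu> \<alpha> i =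
     - \<mu> - (\<Sum>z\<in>support_points data Q. \<alpha> z * k z (data i))"

text \<open>Only the values of \<open>\<alpha>\<close> on the support points enter.\<close>

definition dual_objective ::
  "('z \<Rightarrow> 'z \<Rightarrow> real) \<Rightarrow> (real \<Rightarrow> ereal) \<Rightarrow> real \<Rightarrow> ('n::finite \<Rightarrow> 'z) \<Rightarrow> 'z pmf \<Rightarrow>
   real \<times> ('z \<Rightarrow> real) \<Rightarrow> ereal" where
  "dual_objective k \<rho> lam data Q = (\<lambda>(\<mu>, \<alpha>).
     let S = support_points data Q in
     ereal (1 / real CARD('n)) * (\<Sum>i\<in>UNIV. legendre \<rho> (dual_argument k data Q \<mu> \<alpha> i))
     + ereal (\<mu>
         + lam / (4 * real CARD('n)) * (\<Sum>z\<in>S. \<Sum>z'\<in>S. \<alpha> z * k z z' * \<alpha> z')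
         + (\<Sum>z\<in>S. \<alpha> z * measure_pmf.expectation Q (k z))))"

end

theory Submission
  imports Defs
begin

text \<open>
  The Legendre transform of \<open>\<rho>\<close> is differentiable, and its derivative at \<open>y\<close> is the unique maximizer
  of \<open>y x - \<rho> x\<close> on \<open>[0, W]\<close>.  By the reproducing property the squared MMD is a quadratic form in the
  kernel matrix, so that the sum of the primal objective and \<open>\<lambda> / n\<close> times the dual objective is a
  square plus the slacks in Young's inequality, all nonnegative.  A dual minimizer is stationary, and
  stationarity makes both parts vanish at the weights formed by the maximizers: these are
  therefore the primal minimizer.  The duality gap vanishes even if the dual has no minimizer:
  linearizing the square at a primal minimizer leaves a problem with the single constraint
  \<open>\<Sum>i. w\<^sub>i = 1\<close>, whose multiplier \<open>\<mu>\<close> is given by the intermediate value theorem if \<open>W > 1\<close> and is sent to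
  \<open>-\<infinity>\<close> if \<open>W = 1\<close>; for \<open>W < 1\<close> there are no feasible weights and the dual is unbounded below.
\<close>

section \<open>Conjugates of strictly convex functions on a compact interval\<close>

locale strict_convex_conjugate =
  fixes W :: real and r :: "real \<Rightarrow> real"
  assumes W_nonneg: "0 \<le> W"
    and cont_r: "continuous_on {0..W} r"
    and strict: "\<And>x y t. x \<in> {0..W} \<Longrightarrow> y \<in> {0..W} \<Longrightarrow> x \<noteq> y \<Longrightarrow> 0 < t \<Longrightarrow> t < 1 \<Longrightarrow>
                   r ((1 - t) * x + t * y) < (1 - t) * r x + t * r y"
begin

definition maximizer :: "real \<Rightarrow> real" where
  "maximizer y = (SOME x. x \<in> {0..W} \<and> (\<forall>x'\<in>{0..W}. y * x' - r x' \<le> y * x - r x))"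

text \<open>The Legendre transform of the function that equals \<open>r\<close> on
  \<open>{0..W}\<close> and is infinite elsewhere; \<open>legendre_eq\<close> makes the
  link.\<close>

definition conj_r :: "real \<Rightarrow> real" where
  "conj_r y = y * maximizer y - r (maximizer y)"

lemma maximizer_aux:
  "maximizer y \<in> {0..W} \<and> (\<forall>x'\<in>{0..W}. y * x' - r x' \<le> y * maximizer y - r (maximizer y))"
proof -
  have "continuous_on {0..W} (\<lambda>x. y * x - r x)"
    by (intro continuous_intros cont_r)
  from continuous_attains_sup[OF compact_Icc _ this]
  have "\<exists>x. x \<in> {0..W} \<and> (\<forall>x'\<in>{0..W}. y * x' - r x' \<le> y * x - r x)"
    using W_nonneg by auto
  then show ?thesis unfolding maximizer_def by (rule someI_ex)
qed

lemma maximizer_in: "0 \<le> maximizer y" "maximizer y \<le> W"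
  using maximizer_aux[of y] by auto

lemma young: "x \<in> {0..W} \<Longrightarrow> y * x - r x \<le> conj_r y"
  using maximizer_aux[of y] by (simp add: conj_r_def)

text \<open>Two distinct maximizers would, by strict convexity, be beaten by their midpoint.\<close>

lemma maximizer_unique:
  assumes x: "x \<in> {0..W}" and eq: "y * x - r x \<ge> conj_r y"
  shows "x = maximizer y"
proof (rule ccontr)
  let ?m = "maximizer y" and ?h = "(1 - 1/2) * x + 1/2 * maximizer y"
  assume "x \<noteq> ?m"
  then have "r ?h < (1 - 1/2) * r x + 1/2 * r ?m"
    using x maximizer_in by (intro strict) auto
  moreover have "y * ?h - r ?h \<le> conj_r y"
    using x maximizer_in[of y] by (intro young) auto
  ultimately show False
    using eq unfolding conj_r_def by (simp add: algebra_simps)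
qed

text \<open>By compactness and uniqueness, the values at points at distance at least
  \<open>e\<close> from the maximizer stay below the maximum by a fixed gap \<open>g\<close>. A
  small change of \<open>y\<close> perturbs the objective too little to close this gap.\<close>

lemma isCont_maximizer: "isCont maximizer y"
  unfolding continuous_at LIM_def
proof (intro allI impI)
  fix e :: real assume e: "0 < e"
  let ?m = "maximizer y"
  define T where "T = {0..W} \<inter> {x. e \<le> \<bar>x - ?m\<bar>}"
  have T: "compact T"
    unfolding T_def by (intro compact_Int_closed compact_Icc closed_Collect_le continuous_intros)
  obtain g where g: "0 < g" "\<And>x. x \<in> T \<Longrightarrow> y * x - r x \<le> conj_r y - g"
  proof (cases "T = {}")
    case True
    then show ?thesis using that[of 1] by simp
  next
    case False
    have "continuous_on T (\<lambda>x. y * x - r x)"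
      by (intro continuous_intros continuous_on_subset[OF cont_r]) (auto simp: T_def)
    from continuous_attains_sup[OF T False this] obtain s where
      s: "s \<in> T" "\<And>x. x \<in> T \<Longrightarrow> y * x - r x \<le> y * s - r s" by blast
    have "s \<noteq> ?m" "s \<in> {0..W}" using s(1) e by (auto simp: T_def)
    then have "y * s - r s < conj_r y" using maximizer_unique[of s y] by force
    then show ?thesis using s(2) by (intro that[of "conj_r y - (y * s - r s)"]) auto
  qed
  \<comment> \<open>Two maximizers are at most \<open>W\<close> apart; \<open>W + 1\<close> keeps
    the divisor positive when \<open>W = 0\<close>.\<close>
  have "dist (maximizer y') ?m < e" if y': "dist y' y < g / (W + 1)" for y'
  proof (rule ccontr)
    let ?m' = "maximizer y'"
    assume "\<not> ?thesis"
    then have "?m' \<in> T" using maximizer_in by (auto simp: T_def dist_real_def)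
    then have "y * ?m' - r ?m' \<le> conj_r y - g" by (rule g)
    moreover have "y' * ?m - r ?m \<le> conj_r y'" using maximizer_in by (intro young) auto
    ultimately have "g \<le> (y' - y) * (?m' - ?m)"
      by (simp add: conj_r_def algebra_simps)
    also have "\<dots> \<le> \<bar>y' - y\<bar> * \<bar>?m' - ?m\<bar>" by (metis abs_ge_self abs_mult)
    also have "\<dots> \<le> \<bar>y' - y\<bar> * (W + 1)"
      using maximizer_in[of y] maximizer_in[of y'] by (intro mult_left_mono) auto
    also have "\<dots> < g" using y' W_nonneg by (simp add: dist_real_def field_simps)
    finally show False by simp
  qed
  then show "\<exists>s>0. \<forall>x. x \<noteq> y \<and> dist x y < s \<longrightarrow> dist (maximizer x) ?m < e"
    using g(1) W_nonneg by (intro exI[of _ "g / (W + 1)"]) auto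
qed

text \<open>
  Comparing the maximizers at \<open>y\<close> and \<open>z\<close> squeezes the difference quotient of the conjugate
  between \<open>maximizer y\<close> and \<open>maximizer z\<close>.
\<close>

lemma conj_deriv: "(conj_r has_real_derivative maximizer y) (at y)"
proof -
  have *: "\<bar>(conj_r z - conj_r y) / (z - y) - maximizer y\<bar> \<le> \<bar>maximizer z - maximizer y\<bar>" if "z \<noteq> y" for z
  proof -
    have 1: "z * maximizer y - r (maximizer y) \<le> conj_r z"
      and 2: "y * maximizer z - r (maximizer z) \<le> conj_r y"
      using maximizer_in by (auto intro!: young)
    let ?D = "conj_r z - conj_r y - (z - y) * maximizer y"
    have "0 \<le> ?D" "?D \<le> (z - y) * (maximizer z - maximizer y)"
      using 1 2 by (simp_all add: conj_r_def algebra_simps)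
    then have "\<bar>?D\<bar> \<le> \<bar>maximizer z - maximizer y\<bar> * \<bar>z - y\<bar>"
      by (simp add: abs_mult[symmetric] mult.commute)
    then have "\<bar>?D\<bar> / \<bar>z - y\<bar> \<le> \<bar>maximizer z - maximizer y\<bar>"
      using that by (simp add: pos_divide_le_eq)
    moreover have "(conj_r z - conj_r y) / (z - y) - maximizer y = ?D / (z - y)"
      using that by (simp add: diff_divide_distrib)
    ultimately show ?thesis by simp
  qed
  have "((\<lambda>z. maximizer z - maximizer y) \<longlongrightarrow> 0) (at y)"
    using isCont_maximizer[of y] by (simp add: isCont_def LIM_zero)
  then have "((\<lambda>z. (conj_r z - conj_r y) / (z - y) - maximizer y) \<longlongrightarrow> 0) (at y)"
    by (rule Lim_null_comparison[OF _ tendsto_norm_zero, rotated])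
      (use * in \<open>auto simp: eventually_at_filter\<close>)
  then show ?thesis
    unfolding has_field_derivative_iff by (rule LIM_zero_cancel)
qed

section \<open>Asymptotics of the maximizer and the conjugate\<close>

lemma r_bounded: obtains M where "0 < M" "\<And>x. x \<in> {0..W} \<Longrightarrow> \<bar>r x\<bar> \<le> M"
proof -
  have "bounded (r ` {0..W})"
    by (intro compact_imp_bounded compact_continuous_image cont_r compact_Icc)
  then show ?thesis using that unfolding bounded_pos by auto
qed

text \<open>Comparison with the endpoint \<open>W\<close> bounds
  \<open>y * (W - maximizer y)\<close> by a difference of two values of \<open>r\<close>, hence by
  \<open>2 * M\<close>. At the other end, \<open>0\<close> takes the role of
  \<open>W\<close>.\<close>

lemma maximizer_at_top: "(maximizer \<longlongrightarrow> W) at_top"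
proof -
  obtain M where M: "0 < M" "\<And>x. x \<in> {0..W} \<Longrightarrow> \<bar>r x\<bar> \<le> M" using r_bounded by blast
  have bound: "W - 2 * M / y \<le> maximizer y" if "y > 0" for y
  proof -
    have "y * W - r W \<le> conj_r y" using W_nonneg by (intro young) auto
    then have "y * (W - maximizer y) \<le> 2 * M"
      using M(2)[of W] M(2)[of "maximizer y"] maximizer_in[of y] W_nonneg
      by (auto simp: conj_r_def algebra_simps)
    then show ?thesis using that by (simp add: field_simps)
  qed
  have "((\<lambda>y. 2 * M / y) \<longlongrightarrow> 0) at_top"
    by (intro tendsto_divide_0[OF tendsto_const] filterlim_at_top_imp_at_infinity filterlim_ident)
  then have lim: "((\<lambda>y. W - 2 * M / y) \<longlongrightarrow> W) at_top"
    using tendsto_diff[OF tendsto_const] by fastforce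
  show ?thesis
  proof (rule tendsto_sandwich[OF _ _ lim tendsto_const])
    show "\<forall>\<^sub>F y in at_top. W - 2 * M / y \<le> maximizer y"
      by (rule eventually_mono[OF eventually_gt_at_top[of 0] bound])
  qed (simp add: maximizer_in)
qed

lemma maximizer_at_bot: "(maximizer \<longlongrightarrow> 0) at_bot"
proof -
  obtain M where M: "0 < M" "\<And>x. x \<in> {0..W} \<Longrightarrow> \<bar>r x\<bar> \<le> M" using r_bounded by blast
  have bound: "maximizer y \<le> 2 * M / (- y)" if "y < 0" for y
  proof -
    have "y * 0 - r 0 \<le> conj_r y" using W_nonneg by (intro young) auto
    then have "- y * maximizer y \<le> 2 * M"
      using M(2)[of 0] M(2)[of "maximizer y"] maximizer_in[of y] W_nonneg
      by (auto simp: conj_r_def algebra_simps)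
    then show ?thesis using that by (simp add: field_simps)
  qed
  have lim: "((\<lambda>y. 2 * M / (- y)) \<longlongrightarrow> 0) at_bot"
    by (intro tendsto_divide_0[OF tendsto_const] filterlim_at_top_imp_at_infinity
        filterlim_uminus_at_top_at_bot)
  show ?thesis
  proof (rule tendsto_sandwich[OF _ _ tendsto_const lim])
    show "\<forall>\<^sub>F y in at_bot. maximizer y \<le> 2 * M / (- y)"
      by (rule eventually_mono[OF eventually_gt_at_bot[of 0] bound])
  qed (simp add: maximizer_in)
qed

text \<open>The expression is the slack in Young's inequality at the endpoint \<open>W\<close>. It
  is squeezed between 0 and \<open>r W - r (maximizer y)\<close>, which vanishes in the limit by
  continuity of \<open>r\<close>. This serves the case \<open>W = 1\<close>, where the multiplier is
  sent to infinity.\<close>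

lemma conj_at_top: "((\<lambda>y. conj_r y - (y * W - r W)) \<longlongrightarrow> 0) at_top"
proof -
  have "((\<lambda>y. r (maximizer y)) \<longlongrightarrow> r W) at_top"
    using W_nonneg maximizer_in
    by (intro continuous_on_tendsto_compose[OF cont_r maximizer_at_top]) auto
  then have lim: "((\<lambda>y. r W - r (maximizer y)) \<longlongrightarrow> 0) at_top"
    using tendsto_diff[OF tendsto_const[of "r W"]] by fastforce
  show ?thesis
  proof (rule tendsto_sandwich[OF _ _ tendsto_const lim])
    show "\<forall>\<^sub>F y in at_top. 0 \<le> conj_r y - (y * W - r W)"
      using young[of W] W_nonneg by simp
    have "conj_r y - (y * W - r W) \<le> r W - r (maximizer y)" if "0 < y" for y
      using mult_left_mono[OF maximizer_in(2), of y y] that by (simp add: conj_r_def)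
    then show "\<forall>\<^sub>F y in at_top. conj_r y - (y * W - r W) \<le> r W - r (maximizer y)"
      by (rule eventually_mono[OF eventually_gt_at_top[of 0]])
  qed
qed

end

section \<open>Kernel forms and the maximum mean discrepancy\<close>

text \<open>The bilinear form of the Gram matrix on \<open>S\<close>. On the diagonal it is the
  squared RKHS norm of a combination of kernel sections, see
  \<open>ip_embedding_self\<close>.\<close>

definition kernel_form ::
  "('z \<Rightarrow> 'z \<Rightarrow> real) \<Rightarrow> 'z set \<Rightarrow> ('z \<Rightarrow> real) \<Rightarrow> ('z \<Rightarrow> real) \<Rightarrow> real" where
  "kernel_form k S a b = (\<Sum>z\<in>S. \<Sum>z'\<in>S. a z * k z z' * b z')"

lemma kernel_form_add_left:
  "kernel_form k S (\<lambda>z. a z + b z) c = kernel_form k S a c + kernel_form k S b c"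
  by (simp add: kernel_form_def sum.distrib algebra_simps)

lemma kernel_form_add_right:
  "kernel_form k S c (\<lambda>z. a z + b z) = kernel_form k S c a + kernel_form k S c b"
  by (simp add: kernel_form_def sum.distrib algebra_simps)

lemma kernel_form_scale_left: "kernel_form k S (\<lambda>z. t * a z) b = t * kernel_form k S a b"
  by (simp add: kernel_form_def sum_distrib_left mult.assoc)

lemma kernel_form_scale_right: "kernel_form k S a (\<lambda>z. t * b z) = t * kernel_form k S a b"
  by (simp add: kernel_form_def sum_distrib_left mult_ac)

lemma kernel_form_diff_left:
  "kernel_form k S (\<lambda>z. a z - b z) c = kernel_form k S a c - kernel_form k S b c"
  by (simp add: kernel_form_def sum_subtractf algebra_simps)

lemma kernel_form_diff_right:
  "kernel_form k S c (\<lambda>z. a z - b z) = kernel_form k S c a - kernel_form k S c b"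
  by (simp add: kernel_form_def sum_subtractf algebra_simps)

lemmas kernel_form_linear =
  kernel_form_add_left kernel_form_add_right kernel_form_scale_left kernel_form_scale_right
  kernel_form_diff_left kernel_form_diff_right

lemma kernel_form_eq_left: "kernel_form k S a b = (\<Sum>z\<in>S. a z * (\<Sum>z'\<in>S. k z z' * b z'))"
  by (simp add: kernel_form_def sum_distrib_left mult.assoc)

lemma kernel_form_eq_right: "kernel_form k S a b = (\<Sum>z'\<in>S. b z' * (\<Sum>z\<in>S. a z * k z z'))"
  unfolding kernel_form_def by (subst sum.swap) (simp add: sum_distrib_left mult_ac)

lemma kernel_form_commute:
  assumes "kernel_on Z k" "S \<subseteq> Z"
  shows "kernel_form k S a b = kernel_form k S b a"
proof -
  have "(\<Sum>z\<in>S. \<Sum>z'\<in>S. a z * k z z' * b z') = (\<Sum>z\<in>S. \<Sum>z'\<in>S. b z' * k z' z * a z)"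
    using assms by (intro sum.cong refl) (auto simp: kernel_on_def subset_iff)
  then show ?thesis unfolding kernel_form_def by (subst (2) sum.swap)
qed

lemma kernel_form_nonneg:
  assumes "kernel_on Z k" "S \<subseteq> Z" "finite S"
  shows "0 \<le> kernel_form k S a a"
  using assms by (simp add: kernel_form_def kernel_on_def mult.commute mult.left_commute)

locale rkhs =
  fixes Z :: "'z set" and k :: "'z \<Rightarrow> 'z \<Rightarrow> real" and H :: "('z \<Rightarrow> real) set"
    and ip :: "('z \<Rightarrow> real) \<Rightarrow> ('z \<Rightarrow> real) \<Rightarrow> real"
  assumes rkhs: "is_rkhs Z k H ip"
begin

section \<open>Inner product calculus and kernel mean embeddings\<close>

lemma zero_in: "(\<lambda>_. 0) \<in> H"
  and add_in: "f \<in> H \<Longrightarrow> g \<in> H \<Longrightarrow> (\<lambda>x. f x + g x) \<in> H"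
  and scale_in: "f \<in> H \<Longrightarrow> (\<lambda>x. c * f x) \<in> H"
  and ip_commute: "f \<in> H \<Longrightarrow> g \<in> H \<Longrightarrow> ip f g = ip g f"
  and ip_add: "f \<in> H \<Longrightarrow> g \<in> H \<Longrightarrow> h \<in> H \<Longrightarrow> ip (\<lambda>x. f x + g x) h = ip f h + ip g h"
  and ip_scale: "f \<in> H \<Longrightarrow> g \<in> H \<Longrightarrow> ip (\<lambda>x. c * f x) g = c * ip f g"
  and ip_nonneg: "f \<in> H \<Longrightarrow> 0 \<le> ip f f"
  and section_in: "z \<in> Z \<Longrightarrow> kernel_section Z k z \<in> H"
  and reproducing: "z \<in> Z \<Longrightarrow> f \<in> H \<Longrightarrow> ip f (kernel_section Z k z) = f z"
  using rkhs unfolding is_rkhs_def by blast+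

lemma ip_scale_right: "f \<in> H \<Longrightarrow> g \<in> H \<Longrightarrow> ip f (\<lambda>x. c * g x) = c * ip f g"
  by (metis ip_commute ip_scale scale_in)

text \<open>The squared norm of \<open>f + t g\<close> is a quadratic polynomial in \<open>t\<close>
  that is nonnegative everywhere.\<close>

lemma ip_Cauchy_Schwarz:
  assumes f: "f \<in> H" and g: "g \<in> H"
  shows "(ip f g)\<^sup>2 \<le> ip f f * ip g g"
proof -
  have quadratic: "0 \<le> ip f f + 2 * t * ip f g + t\<^sup>2 * ip g g" for t
  proof -
    let ?h = "\<lambda>x. f x + t * g x"
    have tg: "(\<lambda>x. t * g x) \<in> H" using g by (rule scale_in)
    have h: "?h \<in> H" using f tg by (rule add_in)
    have "ip ?h ?h = ip ?h f + t * ip ?h g"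
      by (subst ip_add[OF f tg h]) (simp add: ip_commute[OF f h] ip_scale[OF g h] ip_commute[OF g h])
    also have "\<dots> = ip f f + t * ip g f + t * (ip f g + t * ip g g)"
      by (simp add: ip_add[OF f tg f] ip_add[OF f tg g] ip_scale[OF g f] ip_scale[OF g g])
    finally show ?thesis
      using ip_nonneg[OF h] by (simp add: ip_commute[OF g f] power2_eq_square algebra_simps)
  qed
  show ?thesis
  proof (cases "ip g g = 0")
    case True
    have "ip f g = 0"
    proof (rule ccontr)
      assume nz: "ip f g \<noteq> 0"
      \<comment> \<open>With \<open>ip g g = 0\<close> the polynomial is affine, and this
        \<open>t\<close> gives it the value -1.\<close>
      show False
        using quadratic[of "- (ip f f + 1) / (2 * ip f g)"] True nz by (simp add: field_simps)
    qed
    then show ?thesis using True by simp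
  next
    case False
    then have pos: "0 < ip g g" using ip_nonneg[OF g] by simp
    \<comment> \<open>The vertex of the parabola.\<close>
    show ?thesis
      using quadratic[of "- ip f g / ip g g"] pos by (simp add: field_simps power2_eq_square)
  qed
qed

lemma sum_in:
  assumes "finite T" "\<And>t. t \<in> T \<Longrightarrow> F t \<in> H"
  shows "(\<lambda>x. \<Sum>t\<in>T. F t x) \<in> H"
  using assms by (induction T rule: finite_induct) (auto intro: zero_in add_in)

lemma ip_sum:
  assumes "finite T" "\<And>t. t \<in> T \<Longrightarrow> F t \<in> H" "h \<in> H"
  shows "ip (\<lambda>x. \<Sum>t\<in>T. F t x) h = (\<Sum>t\<in>T. ip (F t) h)"
  using assms
proof (induction T rule: finite_induct)
  case empty
  then show ?case using ip_scale[OF zero_in, of h 0] by simp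
next
  case (insert t T)
  then show ?case by (simp add: ip_add sum_in)
qed

text \<open>The kernel mean embedding of the signed measure with masses \<open>a\<close> on
  \<open>S\<close>.\<close>

definition embedding :: "'z set \<Rightarrow> ('z \<Rightarrow> real) \<Rightarrow> 'z \<Rightarrow> real" where
  "embedding S a = (\<lambda>x. \<Sum>z\<in>S. a z * kernel_section Z k z x)"

lemma embedding_in: "finite S \<Longrightarrow> S \<subseteq> Z \<Longrightarrow> embedding S a \<in> H"
  unfolding embedding_def by (intro sum_in scale_in section_in) auto

lemma ip_embedding:
  assumes "finite S" "S \<subseteq> Z" "f \<in> H"
  shows "ip (embedding S a) f = (\<Sum>z\<in>S. a z * f z)"
proof -
  have "ip (embedding S a) f = (\<Sum>z\<in>S. ip (\<lambda>x. a z * kernel_section Z k z x) f)"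
    unfolding embedding_def using assms by (intro ip_sum scale_in section_in) auto
  also have "\<dots> = (\<Sum>z\<in>S. a z * f z)"
  proof (intro sum.cong refl)
    fix z assume "z \<in> S"
    then have z: "z \<in> Z" using assms by auto
    show "ip (\<lambda>x. a z * kernel_section Z k z x) f = a z * f z"
      by (simp add: ip_scale[OF section_in[OF z] assms(3)] ip_commute[OF section_in[OF z] assms(3)]
          reproducing[OF z assms(3)])
  qed
  finally show ?thesis .
qed

lemma ip_embedding_self:
  assumes "finite S" "S \<subseteq> Z"
  shows "ip (embedding S a) (embedding S a) = kernel_form k S a a"
proof -
  have "embedding S a z = (\<Sum>z'\<in>S. a z' * k z' z)" if "z \<in> S" for z
    using that assms by (auto simp: embedding_def kernel_section_def)
  then show ?thesis
    unfolding ip_embedding[OF assms embedding_in[OF assms]] kernel_form_eq_right by simp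
qed

text \<open>With \<open>h\<close> the embedding of the signed measure \<open>P - Q\<close>, the
  difference of expectations of \<open>f\<close> is \<open>ip f h\<close>. By Cauchy-Schwarz its
  supremum over the unit ball is the norm of \<open>h\<close>, attained at the normalized
  \<open>h\<close>.\<close>

lemma mmd_square:
  assumes S: "finite S" "S \<subseteq> Z" and PQ: "set_pmf P \<subseteq> S" "set_pmf Q \<subseteq> S"
  defines "a \<equiv> \<lambda>z. pmf P z - pmf Q z"
  shows "(mmd H ip P Q)\<^sup>2 = kernel_form k S a a"
proof -
  define h where "h = embedding S a"
  define c where "c = sqrt (ip h h)"
  have h: "h \<in> H" unfolding h_def using S by (rule embedding_in)
  have c: "0 \<le> c" "c\<^sup>2 = ip h h" using ip_nonneg[OF h] by (simp_all add: c_def)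
  have diff: "measure_pmf.expectation P f - measure_pmf.expectation Q f = ip f h" if "f \<in> H" for f
  proof -
    have "measure_pmf.expectation P f - measure_pmf.expectation Q f
        = (\<Sum>z\<in>S. f z * pmf P z) - (\<Sum>z\<in>S. f z * pmf Q z)"
      using PQ S(1) by (subst (1 2) integral_measure_pmf_real[of S]) auto
    also have "\<dots> = (\<Sum>z\<in>S. a z * f z)"
      by (simp add: a_def sum_subtractf[symmetric] algebra_simps)
    also have "\<dots> = ip f h"
      unfolding h_def ip_embedding[OF S that, symmetric]
      by (rule ip_commute[OF embedding_in[OF S] that])
    finally show ?thesis .
  qed
  have "mmd H ip P Q = (SUP f\<in>{f \<in> H. sqrt (ip f f) \<le> 1}. \<bar>ip f h\<bar>)"
    unfolding mmd_def by (intro SUP_cong refl) (simp add: diff)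
  also have "\<dots> = c"
  proof (rule cSup_eq_maximum)
    have "\<exists>f\<in>H. sqrt (ip f f) \<le> 1 \<and> \<bar>ip f h\<bar> = c"
    \<comment> \<open>A vanishing \<open>h\<close> cannot be normalized, but then the zero function
      attains the supremum.\<close>
    proof (cases "c = 0")
      case True
      have "ip (\<lambda>_. 0) g = 0" if "g \<in> H" for g
        using ip_scale[OF zero_in that, of 0] by simp
      then show ?thesis using True h by (intro bexI[OF _ zero_in]) (simp add: zero_in)
    next
      case False
      let ?f = "\<lambda>x. (1 / c) * h x"
      have f: "?f \<in> H" using h by (rule scale_in)
      have fh: "ip ?f h = c"
        using False c by (simp only: ip_scale[OF h h]) (simp add: c(2)[symmetric] power2_eq_square)
      have "ip ?f ?f = 1"
        unfolding ip_scale_right[OF f h] fh using False by simp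
      then show ?thesis using f fh c(1) by (intro bexI[OF _ f]) simp
    qed
    then show "c \<in> (\<lambda>f. \<bar>ip f h\<bar>) ` {f \<in> H. sqrt (ip f f) \<le> 1}" by auto
  next
    fix x assume "x \<in> (\<lambda>f. \<bar>ip f h\<bar>) ` {f \<in> H. sqrt (ip f f) \<le> 1}"
    then obtain f where f: "f \<in> H" "sqrt (ip f f) \<le> 1" "x = \<bar>ip f h\<bar>" by auto
    have "\<bar>ip f h\<bar>\<^sup>2 \<le> ip f f * c\<^sup>2" using ip_Cauchy_Schwarz[OF f(1) h] c by simp
    also have "\<dots> \<le> 1 * c\<^sup>2" using f(2) by (intro mult_right_mono) auto
    finally show "x \<le> c" using f(3) c(1) power2_le_imp_le[of "\<bar>ip f h\<bar>" c] by simp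
  qed
  finally show ?thesis using c(2) ip_embedding_self[OF S] by (simp add: h_def)
qed

end

section \<open>Duality for the weighting problem\<close>

text \<open>Divide by \<open>t\<close> and let \<open>t\<close> decrease to 0. This gives the
  first-order condition for a minimum at the start of a segment.\<close>

lemma nonneg_slope_at_0:
  fixes l q :: real
  assumes "\<And>t. 0 < t \<Longrightarrow> t < 1 \<Longrightarrow> 0 \<le> t * l + t * t * q"
  shows "0 \<le> l"
proof (rule tendsto_lowerbound)
  show "((\<lambda>t. l + t * q) \<longlongrightarrow> l) (at_right 0)"
    by (auto intro!: tendsto_eq_intros)
  have "0 \<le> l + t * q" if "0 < t" "t < 1" for t
    using assms[OF that] that
    by (simp add: mult.assoc distrib_left[symmetric] zero_le_mult_iff del: distrib_left)
  then show "\<forall>\<^sub>F t in at_right 0. 0 \<le> l + t * q"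
    unfolding eventually_at_right_field by (intro exI[of _ 1]) auto
qed simp

text \<open>If \<open>x\<close> or \<open>y\<close> lies outside \<open>C\<close>, the right-hand
  side of the convexity inequality is infinite, so only points of \<open>C\<close> matter.\<close>

lemma proper_convexI:
  fixes f :: "'x \<Rightarrow> ereal"
  assumes f: "\<And>x. f x = (if x \<in> C then ereal (\<phi> x) else \<infinity>)"
    and "C \<noteq> {}"
    and closed: "\<And>x y t. x \<in> C \<Longrightarrow> y \<in> C \<Longrightarrow> 0 < t \<Longrightarrow> t < 1 \<Longrightarrow> comb t x y \<in> C"
    and convex: "\<And>x y t. x \<in> C \<Longrightarrow> y \<in> C \<Longrightarrow> 0 < t \<Longrightarrow> t < 1 \<Longrightarrow>
      \<phi> (comb t x y) \<le> (1 - t) * \<phi> x + t * \<phi> y"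
  shows "proper_convex comb f"
  unfolding proper_convex_def
proof (intro conjI allI ballI)
  show "f x \<noteq> - \<infinity>" for x by (simp add: f)
  show "\<exists>x. f x \<noteq> \<infinity>" using \<open>C \<noteq> {}\<close> by (auto simp: f)
  show "f (comb t x y) \<le> ereal (1 - t) * f x + ereal t * f y" if "t \<in> {0<..<1}" for x y t
    using that closed[of x y t] convex[of x y t] by (auto simp: f)
qed

lemma conjugate_eqI:
  assumes "\<And>x. ereal (pair x y) - f x \<le> c" "ereal (pair x\<^sub>0 y) - f x\<^sub>0 = c"
  shows "conjugate pair f y = c"
  unfolding conjugate_def
proof (rule antisym)
  show "(SUP x. ereal (pair x y) - f x) \<le> c" by (rule SUP_least) (rule assms(1))
  show "c \<le> (SUP x. ereal (pair x y) - f x)"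
    by (rule SUP_upper2[of x\<^sub>0]) (simp_all add: assms(2))
qed

locale mmd_weighting = rkhs Z k H ip
  for Z :: "'z set" and k H ip +
  fixes data :: "'n::finite \<Rightarrow> 'z" and Q :: "'z pmf" and \<rho> :: "real \<Rightarrow> ereal" and W lam :: real
  assumes kernel: "kernel_on Z k"
    and data: "range data \<subseteq> Z"
    and Q: "finite (set_pmf Q)" "set_pmf Q \<subseteq> Z"
    and W: "0 \<le> W"
    and \<rho>_finite: "\<forall>x\<in>{0..W}. \<bar>\<rho> x\<bar> \<noteq> \<infinity>"
    and \<rho>_infinite: "\<forall>x. x \<notin> {0..W} \<longrightarrow> \<rho> x = \<infinity>"
    and \<rho>_convex: "strictly_convex_on {0..W} \<rho>"
    and \<rho>_cont: "continuous_on {0..W} \<rho>"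
    and lam: "0 \<le> lam"
begin

text \<open>Infinite values become 0, so \<open>r\<close> stands for \<open>\<rho>\<close> on
  \<open>{0..W}\<close> only.\<close>

definition r :: "real \<Rightarrow> real" where "r x = real_of_ereal (\<rho> x)"

lemma \<rho>_eq: "x \<in> {0..W} \<Longrightarrow> \<rho> x = ereal (r x)"
  using \<rho>_finite by (simp add: r_def ereal_real)

sublocale strict_convex_conjugate W r
proof
  show "continuous_on {0..W} r"
    using \<rho>_cont \<rho>_finite by (subst (asm) continuous_on_iff_real) (auto simp: comp_def r_def[abs_def])
  show "r ((1 - t) * x + t * y) < (1 - t) * r x + t * r y"
    if "x \<in> {0..W}" "y \<in> {0..W}" "x \<noteq> y" "0 < t" "t < 1" for x y t
  proof -
    have "(1 - t) * x + t * y \<in> {0..W}"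
      using convexD_alt[of "{0..W}" x y t] that by simp
    moreover have "\<rho> ((1 - t) * x + t * y) < ereal (1 - t) * \<rho> x + ereal t * \<rho> y"
      using \<rho>_convex that by (simp add: strictly_convex_on_def)
    ultimately show ?thesis using that(1,2) by (simp add: \<rho>_eq)
  qed
qed (rule W)

abbreviation S :: "'z set" where "S \<equiv> support_points data Q"
abbreviation mean :: "'z \<Rightarrow> real" where "mean \<equiv> \<lambda>z. measure_pmf.expectation Q (k z)"
abbreviation arg :: "real \<Rightarrow> ('z \<Rightarrow> real) \<Rightarrow> 'n \<Rightarrow> real" where "arg \<equiv> dual_argument k data Q"
abbreviation form :: "('z \<Rightarrow> real) \<Rightarrow> ('z \<Rightarrow> real) \<Rightarrow> real" where "form \<equiv> kernel_form k S"

text \<open>The masses of the weighted distribution minus \<open>Q\<close>; data points may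
  coincide, hence the sum. Avoiding \<open>weighted_dist\<close> gives a formula that is affine in
  \<open>w\<close> on the whole space.\<close>

definition diff :: "real ^ 'n \<Rightarrow> 'z \<Rightarrow> real" where
  "diff w z = (\<Sum>i\<in>UNIV. if data i = z then w $ i else 0) - pmf Q z"

definition primal :: "real ^ 'n \<Rightarrow> real" where
  "primal w = form (diff w) (diff w) + lam / real CARD('n) * ((\<Sum>i\<in>UNIV. r (real CARD('n) * w $ i)) / real CARD('n))"

definition dual :: "real \<Rightarrow> ('z \<Rightarrow> real) \<Rightarrow> real" where
  "dual \<mu> \<alpha> = (\<Sum>i\<in>UNIV. conj_r (arg \<mu> \<alpha> i)) / real CARD('n) + \<mu> + lam / (4 * real CARD('n)) * form \<alpha> \<alpha>
     + (\<Sum>z\<in>S. \<alpha> z * mean z)"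

lemma S_eq: "S = range data \<union> set_pmf Q"
  by (simp add: support_points_def empirical_dist_def)

lemma S: "finite S" "S \<subseteq> Z" "data i \<in> S" "set_pmf Q \<subseteq> S"
  using data Q by (auto simp: S_eq)

lemmas form_commute = kernel_form_commute[OF kernel S(2)]
lemmas form_nonneg = kernel_form_nonneg[OF kernel S(2,1)]

lemma expectation_Q: "measure_pmf.expectation Q g = (\<Sum>z\<in>S. g z * pmf Q z)"
  using S by (intro integral_measure_pmf_real) auto

lemma sum_diff:
  "(\<Sum>z\<in>S. diff w z * g z) = (\<Sum>i\<in>UNIV. w $ i * g (data i)) - measure_pmf.expectation Q g"
proof -
  have "(\<Sum>z\<in>S. (\<Sum>i\<in>UNIV. if data i = z then w $ i else 0) * g z)
      = (\<Sum>i\<in>UNIV. \<Sum>z\<in>S. if data i = z then w $ i * g z else 0)"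
    unfolding sum_distrib_right by (subst sum.swap) (intro sum.cong refl, simp)
  also have "\<dots> = (\<Sum>i\<in>UNIV. w $ i * g (data i))"
    by (intro sum.cong refl) (simp add: S)
  finally show ?thesis
    by (simp add: diff_def expectation_Q left_diff_distrib sum_subtractf mult.commute[of "pmf Q _"])
qed

lemma form_diff:
  "form \<alpha> (diff w)
    = (\<Sum>i\<in>UNIV. w $ i * (\<Sum>z\<in>S. \<alpha> z * k z (data i))) - (\<Sum>z\<in>S. \<alpha> z * mean z)"
proof -
  have "(\<Sum>z\<in>S. \<alpha> z * mean z) = (\<Sum>z'\<in>S. (\<Sum>z\<in>S. \<alpha> z * k z z') * pmf Q z')"
    unfolding expectation_Q sum_distrib_left sum_distrib_right
    by (subst sum.swap) (simp add: mult.assoc)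
  then show ?thesis by (simp add: kernel_form_eq_right sum_diff expectation_Q)
qed

lemma arg_eq: "arg \<mu> \<alpha> i = - \<mu> - (\<Sum>z\<in>S. \<alpha> z * k z (data i))"
  by (simp add: dual_argument_def)

lemma sum_arg:
  "(\<Sum>i\<in>UNIV. arg \<mu> \<alpha> i * w $ i)
    = - \<mu> * (\<Sum>i\<in>UNIV. w $ i) - form \<alpha> (diff w) - (\<Sum>z\<in>S. \<alpha> z * mean z)"
  by (simp add: arg_eq form_diff left_diff_distrib sum_subtractf sum_distrib_left
      sum_distrib_right sum_negf mult.commute[of "w $ _"])

lemma feasible_scaled: "w \<in> feasible_weights W \<Longrightarrow> real CARD('n) * w $ i \<in> {0..W}" for w :: "real ^ 'n"
  by (auto simp: feasible_weights_def field_simps)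

lemma feasible_sum: "w \<in> feasible_weights W \<Longrightarrow> (\<Sum>i\<in>UNIV. w $ i) = 1"
  by (simp add: feasible_weights_def)

lemma feasibleI:
  "(\<And>i. real CARD('n) * w $ i \<in> {0..W}) \<Longrightarrow> (\<Sum>i\<in>UNIV. w $ i) = 1 \<Longrightarrow> w \<in> feasible_weights W"
  for w :: "real ^ 'n"
  by (auto simp: feasible_weights_def field_simps zero_le_mult_iff)

lemma pmf_weighted_dist:
  assumes "w \<in> feasible_weights W"
  shows "pmf (weighted_dist data w) z = (\<Sum>i\<in>UNIV. if data i = z then w $ i else 0)"
proof -
  have w: "0 \<le> w $ i" "(\<Sum>i\<in>UNIV. w $ i) = 1" for i
    using assms by (auto simp: feasible_weights_def)
  have "pmf (embed_pmf (\<lambda>i. w $ i)) i = w $ i" for i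
    using w by (intro pmf_embed_pmf) (simp_all add: nn_integral_count_space_finite)
  then show ?thesis
    by (simp add: weighted_dist_def pmf_map measure_measure_pmf_finite sum.inter_filter[symmetric]
        vimage_def)
qed

lemma primal_objective_eq:
  assumes "w \<in> feasible_weights W"
  shows "primal_objective H ip \<rho> lam data Q w = ereal (primal w)"
proof -
  have "set_pmf (weighted_dist data w) \<subseteq> S"
    by (auto simp: weighted_dist_def S)
  then have "(mmd H ip (weighted_dist data w) Q)\<^sup>2 = form (diff w) (diff w)"
    using S assms by (subst mmd_square[of S]) (auto simp: pmf_weighted_dist diff_def[abs_def])
  moreover have "R_n \<rho> w = ereal ((\<Sum>i\<in>UNIV. r (real CARD('n) * w $ i)) / (real CARD('n))\<^sup>2)"
    using feasible_scaled[OF assms] by (simp add: R_n_def \<rho>_eq)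
  ultimately show ?thesis
    by (simp add: primal_objective_def primal_def power2_eq_square)
qed

lemma legendre_eq: "legendre \<rho> y = ereal (conj_r y)"
  unfolding legendre_def conjugate_def
proof (rule antisym)
  show "(SUP x. ereal (x * y) - \<rho> x) \<le> ereal (conj_r y)"
  proof (rule SUP_least)
    fix x show "ereal (x * y) - \<rho> x \<le> ereal (conj_r y)"
      using young[of x y] \<rho>_infinite by (cases "x \<in> {0..W}") (auto simp: \<rho>_eq mult.commute)
  qed
  show "ereal (conj_r y) \<le> (SUP x. ereal (x * y) - \<rho> x)"
    using maximizer_in[of y]
    by (intro SUP_upper2[of "maximizer y"]) (simp_all add: \<rho>_eq conj_r_def mult.commute)
qed

lemma dual_objective_eq: "dual_objective k \<rho> lam data Q (\<mu>, \<alpha>) = ereal (dual \<mu> \<alpha>)"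
  by (simp add: dual_objective_def Let_def legendre_eq dual_def kernel_form_def)

text \<open>Both duality and the optimality conditions are read off from this sum of nonnegative terms.\<close>

lemma duality_gap:
  fixes w \<alpha> \<mu>
  assumes "(\<Sum>i\<in>UNIV. w $ i) = 1"
  defines "e \<equiv> \<lambda>z. diff w z - lam / (2 * real CARD('n)) * \<alpha> z"
  shows "primal w + lam / real CARD('n) * dual \<mu> \<alpha> = form e e
    + lam / real CARD('n) * ((\<Sum>i\<in>UNIV. conj_r (arg \<mu> \<alpha> i) - (arg \<mu> \<alpha> i * (real CARD('n) * w $ i) - r (real CARD('n) * w $ i))) / real CARD('n))"
proof -
  have "(\<Sum>i\<in>UNIV. arg \<mu> \<alpha> i * (real CARD('n) * w $ i))
      = real CARD('n) * (\<Sum>i\<in>UNIV. arg \<mu> \<alpha> i * w $ i)"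
    by (simp add: sum_distrib_left mult_ac)
  also have "\<dots> = real CARD('n) * (- \<mu> - form \<alpha> (diff w) - (\<Sum>z\<in>S. \<alpha> z * mean z))"
    by (simp add: sum_arg assms(1))
  finally have gap:
    "(\<Sum>i\<in>UNIV. conj_r (arg \<mu> \<alpha> i) - (arg \<mu> \<alpha> i * (real CARD('n) * w $ i)
        - r (real CARD('n) * w $ i))) / real CARD('n)
      = (\<Sum>i\<in>UNIV. conj_r (arg \<mu> \<alpha> i)) / real CARD('n)
        + (\<Sum>i\<in>UNIV. r (real CARD('n) * w $ i)) / real CARD('n)
        + \<mu> + form \<alpha> (diff w) + (\<Sum>z\<in>S. \<alpha> z * mean z)"
    by (simp add: sum_subtractf diff_divide_distrib)
  \<comment> \<open>This factor completes the square: \<open>2 * c\<close> is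
    \<open>lam / n\<close>, and \<open>c * c\<close> is \<open>lam / n\<close> times the dual
    coefficient \<open>lam / (4 * n)\<close>.\<close>
  define c where "c = lam / (2 * real CARD('n))"
  have e: "e = (\<lambda>z. diff w z - c * \<alpha> z)" by (simp add: e_def c_def)
  have "form e e = form (diff w) (diff w) - c * form (diff w) \<alpha>
      - (c * form \<alpha> (diff w) - c * (c * form \<alpha> \<alpha>))"
    unfolding e kernel_form_diff_left kernel_form_diff_right kernel_form_scale_left
      kernel_form_scale_right by (simp add: right_diff_distrib)
  also have "\<dots> = form (diff w) (diff w) - 2 * c * form \<alpha> (diff w) + c * c * form \<alpha> \<alpha>"
    by (simp add: form_commute[of "diff w" \<alpha>])
  also have "\<dots> = form (diff w) (diff w) - lam / real CARD('n) * form \<alpha> (diff w)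
      + lam / real CARD('n) * (lam / (4 * real CARD('n)) * form \<alpha> \<alpha>)"
    by (simp add: c_def)
  finally have form: "form e e = form (diff w) (diff w) - lam / real CARD('n) * form \<alpha> (diff w)
      + lam / real CARD('n) * (lam / (4 * real CARD('n)) * form \<alpha> \<alpha>)" .
  show ?thesis
    unfolding primal_def dual_def gap form by (simp only: distrib_left)
qed

section \<open>Weak duality, stationarity of the dual and recovery of the weights\<close>

lemma weak_duality:
  assumes "w \<in> feasible_weights W"
  shows "- (lam / real CARD('n) * dual \<mu> \<alpha>) \<le> primal w"
proof -
  have "0 \<le> conj_r y - (y * x - r x)" if "x \<in> {0..W}" for x y
    using young[OF that, of y] by simp
  then have "0 \<le> primal w + lam / real CARD('n) * dual \<mu> \<alpha>"
    unfolding duality_gap[OF feasible_sum[OF assms]] using feasible_scaled[OF assms] lam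
    by (intro add_nonneg_nonneg form_nonneg mult_nonneg_nonneg divide_nonneg_nonneg sum_nonneg) auto
  then show ?thesis by simp
qed

text \<open>The weights that give equality in Young's inequality at every data point.\<close>

definition dual_weights :: "real \<Rightarrow> ('z \<Rightarrow> real) \<Rightarrow> real ^ 'n" where
  "dual_weights \<mu> \<alpha> = (\<chi> i. maximizer (arg \<mu> \<alpha> i) / real CARD('n))"

text \<open>The derivative of the conjugate is the maximizer, which brings in the weights;
  \<open>form_diff\<close> then merges the terms linear in \<open>\<beta>\<close> with the
  derivative of the quadratic term. The direction is arbitrary, so a minimizer annihilates the whole
  expression.\<close>

lemma dual_directional_deriv:
  fixes \<mu> \<nu> \<alpha> \<beta>
  defines "w\<^sub>0 \<equiv> dual_weights \<mu> \<alpha>"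
  shows "((\<lambda>t. dual (\<mu> + t * \<nu>) (\<lambda>z. \<alpha> z + t * \<beta> z)) has_real_derivative
           \<nu> * (1 - (\<Sum>i\<in>UNIV. w\<^sub>0 $ i))
           - form \<beta> (\<lambda>z. diff w\<^sub>0 z - lam / (2 * real CARD('n)) * \<alpha> z)) (at 0)"
proof -
  define b where "b i = (\<Sum>z\<in>S. \<beta> z * k z (data i))" for i
  have arg: "arg (\<mu> + t * \<nu>) (\<lambda>z. \<alpha> z + t * \<beta> z) i = arg \<mu> \<alpha> i + t * (- \<nu> - b i)" for t i
    by (simp add: arg_eq b_def sum.distrib sum_distrib_left algebra_simps)
  have mean: "(\<Sum>z\<in>S. (\<alpha> z + t * \<beta> z) * mean z)
      = (\<Sum>z\<in>S. \<alpha> z * mean z) + t * (\<Sum>z\<in>S. \<beta> z * mean z)" for t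
    by (simp add: sum.distrib sum_distrib_left algebra_simps)
  have conj: "((\<lambda>t. conj_r (arg \<mu> \<alpha> i + t * (- \<nu> - b i))) has_real_derivative
      maximizer (arg \<mu> \<alpha> i) * (- \<nu> - b i)) (at 0)" for i
    by (rule DERIV_chain2[where f = conj_r])
      (auto intro!: derivative_eq_intros simp: conj_deriv)
  have "((\<lambda>t. dual (\<mu> + t * \<nu>) (\<lambda>z. \<alpha> z + t * \<beta> z)) has_real_derivative
      (\<Sum>i\<in>UNIV. maximizer (arg \<mu> \<alpha> i) * (- \<nu> - b i)) / real CARD('n) + \<nu>
      + lam / (4 * real CARD('n)) * (form \<beta> \<alpha> + form \<alpha> \<beta>) + (\<Sum>z\<in>S. \<beta> z * mean z)) (at 0)"
    unfolding dual_def arg mean kernel_form_add_left kernel_form_add_right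
      kernel_form_scale_left kernel_form_scale_right
    by (auto intro!: derivative_eq_intros DERIV_sum conj)
  moreover have "(\<Sum>i\<in>UNIV. maximizer (arg \<mu> \<alpha> i) * (- \<nu> - b i)) / real CARD('n)
      = - \<nu> * (\<Sum>i\<in>UNIV. w\<^sub>0 $ i) - (\<Sum>i\<in>UNIV. w\<^sub>0 $ i * b i)"
    unfolding sum_divide_distrib sum_distrib_left sum_subtractf[symmetric]
    by (intro sum.cong refl) (simp add: w\<^sub>0_def dual_weights_def diff_divide_distrib right_diff_distrib)
  moreover have "form \<beta> (\<lambda>z. diff w\<^sub>0 z - lam / (2 * real CARD('n)) * \<alpha> z)
      = (\<Sum>i\<in>UNIV. w\<^sub>0 $ i * b i) - (\<Sum>z\<in>S. \<beta> z * mean z)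
        - lam / (2 * real CARD('n)) * form \<beta> \<alpha>"
    by (simp only: kernel_form_diff_right kernel_form_scale_right form_diff b_def)
  ultimately show ?thesis
    by (elim DERIV_cong) (simp add: form_commute[of \<alpha> \<beta>] right_diff_distrib)
qed

text \<open>
  Stationarity of the dual in \<open>\<mu>\<close> makes the candidate weights feasible, stationarity in \<open>\<alpha>\<close>
  makes the quadratic part of the duality gap vanish.
\<close>

lemma dual_minimizer_gap:
  assumes min: "\<And>\<mu> \<alpha>. dual \<mu>\<^sub>0 \<alpha>\<^sub>0 \<le> dual \<mu> \<alpha>"
  defines "w\<^sub>0 \<equiv> dual_weights \<mu>\<^sub>0 \<alpha>\<^sub>0"
  shows "w\<^sub>0 \<in> feasible_weights W" "primal w\<^sub>0 = - (lam / real CARD('n) * dual \<mu>\<^sub>0 \<alpha>\<^sub>0)"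
proof -
  define e where "e = (\<lambda>z. diff w\<^sub>0 z - lam / (2 * real CARD('n)) * \<alpha>\<^sub>0 z)"
  have stationary: "\<nu> * (1 - (\<Sum>i\<in>UNIV. w\<^sub>0 $ i)) - form \<beta> e = 0" for \<nu> \<beta>
    unfolding e_def w\<^sub>0_def
    by (rule DERIV_local_min[OF dual_directional_deriv zero_less_one]) (simp add: min)
  \<comment> \<open>The direction \<open>\<beta> = 0\<close>, written as a multiple so that the
    scaling rule applies.\<close>
  have "form (\<lambda>z. 0 * e z) e = 0" unfolding kernel_form_scale_left by simp
  then have sum: "(\<Sum>i\<in>UNIV. w\<^sub>0 $ i) = 1" using stationary[of 1 "\<lambda>z. 0 * e z"] by simp
  have scaled: "real CARD('n) * w\<^sub>0 $ i = maximizer (arg \<mu>\<^sub>0 \<alpha>\<^sub>0 i)" for i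
    by (simp add: w\<^sub>0_def dual_weights_def)
  show "w\<^sub>0 \<in> feasible_weights W"
    using sum maximizer_in by (intro feasibleI) (simp_all add: scaled)
  \<comment> \<open>The direction is \<open>e\<close> itself, which turns stationarity into
    vanishing of the square.\<close>
  have "form e e = 0" using stationary[of 0 e] by simp
  then have "primal w\<^sub>0 + lam / real CARD('n) * dual \<mu>\<^sub>0 \<alpha>\<^sub>0 = 0"
    unfolding duality_gap[OF sum] e_def[symmetric] by (simp add: scaled conj_r_def)
  then show "primal w\<^sub>0 = - (lam / real CARD('n) * dual \<mu>\<^sub>0 \<alpha>\<^sub>0)" by simp
qed

text \<open>The dual weights close the duality gap, so for \<open>lam > 0\<close> a primal minimizer
  closes it too. All its Young slacks then vanish, and equality in Young's inequality identifies the
  maximizer. For \<open>lam = 0\<close> the gap carries no information on the slacks; there the dual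
  weights are themselves a primal minimizer, and the assumed uniqueness concludes.\<close>

lemma primal_minimizer_eq:
  assumes min: "\<And>\<mu> \<alpha>. dual \<mu>\<^sub>0 \<alpha>\<^sub>0 \<le> dual \<mu> \<alpha>"
    and w: "w \<in> feasible_weights W" "\<And>w'. w' \<in> feasible_weights W \<Longrightarrow> primal w \<le> primal w'"
    and unique: "lam = 0 \<Longrightarrow> (\<And>w'. w' \<in> feasible_weights W \<Longrightarrow>
      (\<And>w''. w'' \<in> feasible_weights W \<Longrightarrow> primal w' \<le> primal w'') \<Longrightarrow> w' = w)"
  shows "real CARD('n) * w $ i = maximizer (arg \<mu>\<^sub>0 \<alpha>\<^sub>0 i)"
proof -
  define w\<^sub>0 where "w\<^sub>0 = dual_weights \<mu>\<^sub>0 \<alpha>\<^sub>0"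
  have w\<^sub>0: "w\<^sub>0 \<in> feasible_weights W" "primal w\<^sub>0 = - (lam / real CARD('n) * dual \<mu>\<^sub>0 \<alpha>\<^sub>0)"
    unfolding w\<^sub>0_def using dual_minimizer_gap[OF min] by simp_all
  show ?thesis
  proof (cases "lam = 0")
    case True
    \<comment> \<open>For \<open>lam = 0\<close> the value \<open>primal w\<^sub>0\<close> is 0, the
      lower bound from weak duality.\<close>
    have "primal w\<^sub>0 \<le> primal w'" if "w' \<in> feasible_weights W" for w'
      using weak_duality[OF that, of \<mu>\<^sub>0 \<alpha>\<^sub>0] w\<^sub>0(2) by simp
    then have "w\<^sub>0 = w" using unique[OF True w\<^sub>0(1)] by simp
    then show ?thesis by (auto simp: w\<^sub>0_def dual_weights_def)
  next
    case False
    let ?e = "\<lambda>z. diff w z - lam / (2 * real CARD('n)) * \<alpha>\<^sub>0 z"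
    let ?g = "\<lambda>i. conj_r (arg \<mu>\<^sub>0 \<alpha>\<^sub>0 i)
      - (arg \<mu>\<^sub>0 \<alpha>\<^sub>0 i * (real CARD('n) * w $ i) - r (real CARD('n) * w $ i))"
    have g: "0 \<le> ?g i" for i
      using young[OF feasible_scaled[OF w(1)], of "arg \<mu>\<^sub>0 \<alpha>\<^sub>0 i" i] by simp
    have "form ?e ?e + lam / real CARD('n) * ((\<Sum>i\<in>UNIV. ?g i) / real CARD('n)) \<le> 0"
      using w(2)[OF w\<^sub>0(1)] w\<^sub>0(2) duality_gap[OF feasible_sum[OF w(1)], of \<mu>\<^sub>0 \<alpha>\<^sub>0] by simp
    then have "lam / real CARD('n) * ((\<Sum>i\<in>UNIV. ?g i) / real CARD('n)) \<le> 0"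
      using form_nonneg[of ?e] by linarith
    then have "(\<Sum>i\<in>UNIV. ?g i) \<le> 0"
      using False lam by (simp add: divide_le_0_iff mult_le_0_iff)
    then have "(\<Sum>i\<in>UNIV. ?g i) = 0" using g by (intro antisym sum_nonneg) auto
    then have "?g i = 0" using g by (subst (asm) sum_nonneg_eq_0_iff) auto
    then show ?thesis by (intro maximizer_unique feasible_scaled[OF w(1)]) simp
  qed
qed

section \<open>Existence of a primal minimizer and its first-order condition\<close>

lemma continuous_on_diff_weights: "continuous_on A (\<lambda>w. diff w z)"
proof -
  have "continuous_on A (\<lambda>w :: real ^ 'n. if data i = z then w $ i else 0)" for i
    by (cases "data i = z") (auto intro: continuous_intros)
  then show ?thesis unfolding diff_def by (intro continuous_intros)
qed

lemma primal_minimizer_exists: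
  assumes "1 \<le> W"
  obtains w where "w \<in> feasible_weights W" "\<And>w'. w' \<in> feasible_weights W \<Longrightarrow> primal w \<le> primal w'"
proof -
  let ?F = "feasible_weights W :: (real ^ 'n) set"
  have "closed ?F"
    unfolding feasible_weights_def
    by (intro closed_Collect_conj closed_Collect_all closed_Collect_le closed_Collect_eq
        continuous_intros)
  moreover have "bounded ?F"
  proof (rule boundedI)
    fix w :: "real ^ 'n" assume "w \<in> ?F"
    then have "0 \<le> w $ i" "(\<Sum>i\<in>UNIV. w $ i) = 1" for i by (auto simp: feasible_weights_def)
    then show "norm w \<le> 1" using norm_le_l1_cart[of w] by simp
  qed
  ultimately have "compact ?F" by (simp add: compact_eq_bounded_closed)
  moreover have "(\<chi> i. 1 / real CARD('n)) \<in> ?F"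
    using assms by (intro feasibleI) auto
  then have "?F \<noteq> {}" by blast
  moreover have "continuous_on ?F primal"
    unfolding primal_def kernel_form_def using feasible_scaled
    by (intro continuous_intros continuous_on_diff_weights continuous_on_compose2[OF cont_r]) auto
  ultimately show ?thesis
    using that continuous_attains_inf[of ?F primal] by blast
qed

lemma diff_affine: "diff ((1 - t) *\<^sub>R w + t *\<^sub>R w') z = diff w z + t * (diff w' z - diff w z)"
proof -
  have *: "(\<Sum>i\<in>UNIV. if data i = z then ((1 - t) *\<^sub>R w + t *\<^sub>R w') $ i else 0)
     = (1 - t) * (\<Sum>i\<in>UNIV. if data i = z then w $ i else 0)
       + t * (\<Sum>i\<in>UNIV. if data i = z then w' $ i else 0)"
    unfolding sum_distrib_left sum.distrib[symmetric] by (intro sum.cong) auto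
  show ?thesis unfolding diff_def * by (simp add: algebra_simps)
qed

lemma r_convex:
  assumes "x \<in> {0..W}" "y \<in> {0..W}" "0 < t" "t < 1"
  shows "r ((1 - t) * x + t * y) \<le> (1 - t) * r x + t * r y"
  using strict[of x y t] assms by (cases "x = y") (auto simp: algebra_simps)

lemma feasible_convex:
  assumes "w \<in> feasible_weights W" "w' \<in> feasible_weights W" "0 < t" "t < 1"
  shows "(1 - t) *\<^sub>R w + t *\<^sub>R w' \<in> (feasible_weights W :: (real ^ 'n) set)"
proof (rule feasibleI)
  show "(\<Sum>i\<in>UNIV. ((1 - t) *\<^sub>R w + t *\<^sub>R w') $ i) = 1"
    using assms(1,2)[THEN feasible_sum] by (simp add: sum.distrib sum_distrib_left[symmetric])
  show "real CARD('n) * ((1 - t) *\<^sub>R w + t *\<^sub>R w') $ i \<in> {0..W}" for i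
    using convexD_alt[of "{0..W}" "real CARD('n) * w $ i" "real CARD('n) * w' $ i" t]
      feasible_scaled[OF assms(1), of i] feasible_scaled[OF assms(2), of i] assms(3,4)
    by (simp add: algebra_simps)
qed

text \<open>On the segment from \<open>w\<close> to \<open>w'\<close>, convexity of \<open>r\<close>
  bounds the objective by a quadratic polynomial in \<open>t\<close> that agrees with it at
  \<open>t = 0\<close>; minimality makes its slope there nonnegative. Thus \<open>w\<close> also
  minimizes the problem with the square linearized at \<open>w\<close>.\<close>

lemma primal_minimizer_linearized:
  assumes w: "w \<in> feasible_weights W" "\<And>w'. w' \<in> feasible_weights W \<Longrightarrow> primal w \<le> primal w'"
    and w': "w' \<in> feasible_weights W"
  shows "0 \<le> 2 * form (\<lambda>z. diff w' z - diff w z) (diff w) + lam / real CARD('n) *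
    (((\<Sum>i\<in>UNIV. r (real CARD('n) * w' $ i)) - (\<Sum>i\<in>UNIV. r (real CARD('n) * w $ i))) / real CARD('n))"
    (is "0 \<le> ?L")
proof (rule nonneg_slope_at_0)
  define d where "d = (\<lambda>z. diff w' z - diff w z)"
  let ?q = "form d d"
  define R R' where "R = (\<Sum>i\<in>UNIV. r (real CARD('n) * w $ i))"
    and "R' = (\<Sum>i\<in>UNIV. r (real CARD('n) * w' $ i))"
  show "0 \<le> t * ?L + t * t * ?q" if t: "0 < t" "t < 1" for t
  proof -
    let ?v = "(1 - t) *\<^sub>R w + t *\<^sub>R w'"
    have "(\<Sum>i\<in>UNIV. r (real CARD('n) * ?v $ i))
        \<le> (\<Sum>i\<in>UNIV. (1 - t) * r (real CARD('n) * w $ i) + t * r (real CARD('n) * w' $ i))"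
    proof (rule sum_mono)
      fix i
      show "r (real CARD('n) * ?v $ i)
          \<le> (1 - t) * r (real CARD('n) * w $ i) + t * r (real CARD('n) * w' $ i)"
        using r_convex[OF feasible_scaled[OF w(1)] feasible_scaled[OF w'] t, of i i]
        by (simp add: algebra_simps)
    qed
    also have "\<dots> = R + t * (R' - R)"
      unfolding R_def R'_def sum.distrib sum_distrib_left[symmetric] by (simp add: algebra_simps)
    finally have *: "lam / real CARD('n) * ((\<Sum>i\<in>UNIV. r (real CARD('n) * ?v $ i)) / real CARD('n))
        \<le> lam / real CARD('n) * ((R + t * (R' - R)) / real CARD('n))"
      using lam by (intro mult_left_mono divide_right_mono) auto
    have v: "diff ?v = (\<lambda>z. diff w z + t * d z)" by (simp add: diff_affine d_def fun_eq_iff)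
    have "form (diff ?v) (diff ?v)
        = form (diff w) (diff w) + 2 * t * form d (diff w) + t * t * ?q"
      unfolding v kernel_form_add_left kernel_form_add_right kernel_form_scale_left
        kernel_form_scale_right
      by (simp add: form_commute[of "diff w" d] algebra_simps)
    then have "primal ?v \<le> form (diff w) (diff w) + 2 * t * form d (diff w) + t * t * ?q
        + lam / real CARD('n) * ((R + t * (R' - R)) / real CARD('n))"
      unfolding primal_def using * by simp
    also have "\<dots> = primal w + (t * ?L + t * t * ?q)"
      by (simp add: primal_def R_def[symmetric] R'_def[symmetric] d_def[symmetric] distrib_left
          add_divide_distrib)
    finally show ?thesis using w(2)[OF feasible_convex[OF w(1) w' t]] by simp
  qed
qed

text \<open>With this \<open>\<alpha>\<close> the square in the duality gap is zero.\<close>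

lemma exists_small_gap:
  fixes \<epsilon> w
  assumes W1: "1 \<le> W" and lam_pos: "0 < lam" and \<epsilon>: "0 < \<epsilon>"
    and w: "w \<in> feasible_weights W" "\<And>w'. w' \<in> feasible_weights W \<Longrightarrow> primal w \<le> primal w'"
  defines "\<alpha> \<equiv> \<lambda>z. 2 * real CARD('n) / lam * diff w z"
  shows "\<exists>\<mu>. (\<Sum>i\<in>UNIV. conj_r (arg \<mu> \<alpha> i)
    - (arg \<mu> \<alpha> i * (real CARD('n) * w $ i) - r (real CARD('n) * w $ i))) \<le> \<epsilon>"
proof -
  define a where "a i = (\<Sum>z\<in>S. \<alpha> z * k z (data i))" for i
  have arg: "arg \<mu> \<alpha> i = - \<mu> - a i" for \<mu> i by (simp add: arg_eq a_def)
  have at_bot: "filterlim (\<lambda>\<mu>. - \<mu> - a i) at_top at_bot" for i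
    unfolding diff_conv_add_uminus add.commute[of "- _" "- a i"]
    by (intro filterlim_tendsto_add_at_top[OF tendsto_const] filterlim_uminus_at_top_at_bot)
  have at_top: "filterlim (\<lambda>\<mu>. - \<mu> - a i) at_bot at_top" for i
    using filterlim_tendsto_add_at_top[OF tendsto_const[of "a i"] filterlim_ident]
    unfolding filterlim_uminus_at_bot by (simp add: add.commute)
  show ?thesis
  proof (cases "W = 1")
    case True
    \<comment> \<open>The numbers \<open>n * w $ i\<close> are at most 1 and average to 1. All upper
      bounds are therefore active, and the slacks vanish only in the limit \<open>\<mu>\<close> to
      minus infinity.\<close>
    have full: "real CARD('n) * w $ i = W" for i
    proof -
      have le: "0 \<le> 1 - real CARD('n) * w $ j" for j
        using feasible_scaled[OF w(1), of j] True by simp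
      have "(\<Sum>j\<in>UNIV. 1 - real CARD('n) * w $ j) = 0"
        using feasible_sum[OF w(1)] by (simp add: sum_subtractf sum_distrib_left[symmetric])
      then have "1 - real CARD('n) * w $ i = 0"
        using le sum_nonneg_eq_0_iff[of UNIV "\<lambda>j. 1 - real CARD('n) * w $ j"] by simp
      then show ?thesis using True by simp
    qed
    have "((\<lambda>\<mu>. \<Sum>i\<in>UNIV. conj_r (- \<mu> - a i) - ((- \<mu> - a i) * W - r W))
        \<longlongrightarrow> (\<Sum>i\<in>(UNIV :: 'n set). 0)) at_bot"
      by (rule tendsto_sum) (rule filterlim_compose[OF conj_at_top at_bot])
    then have "((\<lambda>\<mu>. \<Sum>i\<in>UNIV. conj_r (- \<mu> - a i) - ((- \<mu> - a i) * W - r W)) \<longlongrightarrow> 0) at_bot"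
      by simp
    from order_tendstoD(2)[OF this \<epsilon>]
    obtain \<mu> where "(\<Sum>i\<in>UNIV. conj_r (- \<mu> - a i) - ((- \<mu> - a i) * W - r W)) < \<epsilon>"
      using eventually_happens'[OF trivial_limit_at_bot_linorder] by blast
    then show ?thesis unfolding arg full by (intro exI[of _ \<mu>]) simp
  next
    case False
    then have "1 < W" using W1 by simp
    \<comment> \<open>The candidate weights sum to \<open>s \<mu> / n\<close>. Since
      \<open>s\<close> tends to \<open>n * W > n\<close> on the left and to 0 on the right, some
      \<open>\<mu>\<close> makes this sum 1.\<close>
    define s where "s \<mu> = (\<Sum>i\<in>UNIV. maximizer (- \<mu> - a i))" for \<mu>
    have "(s \<longlongrightarrow> (\<Sum>i\<in>(UNIV :: 'n set). W)) at_bot"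
      unfolding s_def by (rule tendsto_sum) (rule filterlim_compose[OF maximizer_at_top at_bot])
    then have "\<forall>\<^sub>F \<mu> in at_bot. real CARD('n) < s \<mu>"
      by (rule order_tendstoD(1)) (use \<open>1 < W\<close> in simp)
    then obtain b where b: "\<And>\<mu>. \<mu> \<le> b \<Longrightarrow> real CARD('n) < s \<mu>"
      unfolding eventually_at_bot_linorder by blast
    have "(s \<longlongrightarrow> (\<Sum>i\<in>(UNIV :: 'n set). 0)) at_top"
      unfolding s_def by (rule tendsto_sum) (rule filterlim_compose[OF maximizer_at_bot at_top])
    then have "\<forall>\<^sub>F \<mu> in at_top. s \<mu> < real CARD('n)"
      by (rule order_tendstoD(2)) simp
    then obtain c where c: "\<And>\<mu>. c \<le> \<mu> \<Longrightarrow> s \<mu> < real CARD('n)"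
      unfolding eventually_at_top_linorder by blast
    have "isCont s \<mu>" for \<mu>
      unfolding s_def by (intro continuous_intros isCont_o2[OF _ isCont_maximizer])
    then obtain \<mu> where \<mu>: "s \<mu> = real CARD('n)"
      using IVT2[of s "max b c" "real CARD('n)" b] b[of b] c[of "max b c"] by force
    define w' where "w' = dual_weights \<mu> \<alpha>"
    have scaled: "real CARD('n) * w' $ i = maximizer (arg \<mu> \<alpha> i)" for i
      by (simp add: w'_def dual_weights_def)
    have "(\<Sum>i\<in>UNIV. w' $ i) = 1"
      using \<mu> by (simp add: w'_def dual_weights_def s_def arg sum_divide_distrib[symmetric])
    then have w': "w' \<in> feasible_weights W"
      using maximizer_in by (intro feasibleI) (simp_all add: scaled)
    define D where "D = form (\<lambda>z. diff w' z - diff w z) (diff w)"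
    define R R' where "R = (\<Sum>i\<in>UNIV. r (real CARD('n) * w $ i))"
      and "R' = (\<Sum>i\<in>UNIV. r (real CARD('n) * w' $ i))"
    have D: "form \<alpha> (diff w') - form \<alpha> (diff w) = 2 * real CARD('n) / lam * D"
      unfolding \<alpha>_def D_def kernel_form_scale_left kernel_form_diff_left form_commute[of "diff w'"]
      by (rule right_diff_distrib[symmetric])
    have arg_sum: "(\<Sum>i\<in>UNIV. arg \<mu> \<alpha> i * (real CARD('n) * v $ i))
        = real CARD('n) * (- \<mu> - form \<alpha> (diff v) - (\<Sum>z\<in>S. \<alpha> z * mean z))"
      if "v \<in> feasible_weights W" for v
    proof -
      have "(\<Sum>i\<in>UNIV. arg \<mu> \<alpha> i * (real CARD('n) * v $ i))
          = real CARD('n) * (\<Sum>i\<in>UNIV. arg \<mu> \<alpha> i * v $ i)"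
        unfolding sum_distrib_left by (intro sum.cong refl) simp
      then show ?thesis unfolding sum_arg feasible_sum[OF that] by simp
    qed
    \<comment> \<open>The conjugates are attained at \<open>w'\<close>, so the total slack of
      \<open>w\<close> is a negative multiple of the increase of the linearized objective from
      \<open>w\<close> to \<open>w'\<close>. That increase is nonnegative.\<close>
    have "(\<Sum>i\<in>UNIV. conj_r (arg \<mu> \<alpha> i)
        - (arg \<mu> \<alpha> i * (real CARD('n) * w $ i) - r (real CARD('n) * w $ i)))
      = - (real CARD('n) * (form \<alpha> (diff w') - form \<alpha> (diff w))) - (R' - R)"
      unfolding conj_r_def scaled[symmetric] sum_subtractf arg_sum[OF w(1)] arg_sum[OF w']
        R_def R'_def
      by (simp only: right_diff_distrib)
    also have "\<dots> = - (real CARD('n) * real CARD('n) / lam)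
        * (2 * D + lam / real CARD('n) * ((R' - R) / real CARD('n)))"
      unfolding D distrib_left using lam_pos by simp
    also have "\<dots> \<le> 0"
      using primal_minimizer_linearized[OF w w'] lam_pos unfolding R_def R'_def D_def
      by (intro mult_nonpos_nonneg) simp_all
    finally show ?thesis using \<epsilon> by (intro exI[of _ \<mu>]) simp
  qed
qed

lemma feasible_empty:
  assumes "W < 1"
  shows "(feasible_weights W :: (real ^ 'n) set) = {}"
proof (rule equals0I)
  fix w :: "real ^ 'n" assume w: "w \<in> feasible_weights W"
  have "real CARD('n) = (\<Sum>i\<in>UNIV. real CARD('n) * w $ i)"
    using feasible_sum[OF w] by (simp add: sum_distrib_left[symmetric])
  also have "\<dots> \<le> (\<Sum>i\<in>(UNIV :: 'n set). W)"
    using feasible_scaled[OF w] by (intro sum_mono) auto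
  also have "\<dots> < real CARD('n)" using assms by simp
  finally show False by simp
qed

text \<open>At \<open>\<alpha> = 0\<close> the dual is \<open>conj_r (- \<mu>) + \<mu>\<close>,
  which for \<open>\<mu> \<le> 0\<close> is at most \<open>\<mu> * (1 - W) + M\<close>. The chosen
  \<open>\<mu>\<close> makes this bound equal to \<open>- \<bar>B\<bar>\<close>.\<close>

lemma dual_unbounded:
  assumes "W < 1"
  shows "\<exists>\<mu>. dual \<mu> (\<lambda>_. 0) \<le> B"
proof -
  obtain M where M: "0 < M" "\<And>x. x \<in> {0..W} \<Longrightarrow> \<bar>r x\<bar> \<le> M" using r_bounded by blast
  define \<mu> where "\<mu> = (- \<bar>B\<bar> - M) / (1 - W)"
  have "\<mu> \<le> 0" using assms M(1) by (simp add: \<mu>_def divide_le_0_iff)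
  then have "- \<mu> * maximizer (- \<mu>) \<le> - \<mu> * W"
    using maximizer_in by (intro mult_left_mono) auto
  moreover have "- r (maximizer (- \<mu>)) \<le> M"
    using M(2)[of "maximizer (- \<mu>)"] maximizer_in[of "- \<mu>"] by auto
  ultimately have "conj_r (- \<mu>) + \<mu> \<le> \<mu> * (1 - W) + M"
    by (simp add: conj_r_def right_diff_distrib)
  also have "\<dots> = - \<bar>B\<bar>" using assms by (simp add: \<mu>_def)
  finally have "conj_r (- \<mu>) + \<mu> \<le> B" by linarith
  then show ?thesis
    by (intro exI[of _ \<mu>]) (simp add: dual_def arg_eq kernel_form_def)
qed

text \<open>For \<open>W < 1\<close> both sides are infinite. Otherwise the primal minimum is
  attained, weak duality bounds the dual from below, and \<open>exists_small_gap\<close> gives dual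
  points within every \<open>\<epsilon>\<close> of that bound.\<close>

lemma strong_duality:
  assumes lam_pos: "0 < lam"
  shows "(INF w\<in>feasible_weights W. primal_objective H ip \<rho> lam data Q w)
    = ereal (- (lam / real CARD('n))) * (INF y. dual_objective k \<rho> lam data Q y)"
proof (cases "W < 1")
  case True
  have "(INF y. dual_objective k \<rho> lam data Q y) = - \<infinity>"
  proof (rule ereal_bot)
    fix B
    obtain \<mu> where "dual \<mu> (\<lambda>_. 0) \<le> B" using dual_unbounded[OF True] by blast
    then show "(INF y. dual_objective k \<rho> lam data Q y) \<le> ereal B"
      by (intro INF_lower2[of "(\<mu>, \<lambda>_. 0)"]) (simp_all add: dual_objective_eq)
  qed
  then show ?thesis using lam_pos by (simp add: feasible_empty[OF True] top_ereal_def divide_less_0_iff)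
next
  case False
  let ?c = "lam / real CARD('n)"
  have c: "0 < ?c" using lam_pos by simp
  have W1: "1 \<le> W" using False by simp
  obtain w where w: "w \<in> feasible_weights W" "\<And>w'. w' \<in> feasible_weights W \<Longrightarrow> primal w \<le> primal w'"
    using primal_minimizer_exists[OF W1] by blast
  define \<alpha> where "\<alpha> = (\<lambda>z. 2 * real CARD('n) / lam * diff w z)"
  have "(INF w\<in>feasible_weights W. primal_objective H ip \<rho> lam data Q w) = ereal (primal w)"
    using w by (intro antisym INF_lower2[OF w(1)] INF_greatest) (simp_all add: primal_objective_eq)
  moreover have "(INF y. dual_objective k \<rho> lam data Q y) = ereal (- primal w / ?c)"
  proof (rule antisym)
    show "ereal (- primal w / ?c) \<le> (INF y. dual_objective k \<rho> lam data Q y)"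
    proof (rule INF_greatest)
      fix y :: "real \<times> ('z \<Rightarrow> real)"
      have "- primal w \<le> dual (fst y) (snd y) * ?c"
        using weak_duality[OF w(1), of "fst y" "snd y"] by (simp add: mult.commute)
      then have "- primal w / ?c \<le> dual (fst y) (snd y)" using c pos_divide_le_eq by blast
      then show "ereal (- primal w / ?c) \<le> dual_objective k \<rho> lam data Q y"
        using dual_objective_eq[of "fst y" "snd y"] by simp
    qed
    show "(INF y. dual_objective k \<rho> lam data Q y) \<le> ereal (- primal w / ?c)"
    proof (rule ereal_le_epsilon2)
      fix \<epsilon> :: real assume \<epsilon>: "0 < \<epsilon>"
      let ?g = "\<lambda>\<mu> i. conj_r (arg \<mu> \<alpha> i)
        - (arg \<mu> \<alpha> i * (real CARD('n) * w $ i) - r (real CARD('n) * w $ i))"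
      \<comment> \<open>The duality gap divides the sum of slacks by \<open>n\<close>.\<close>
      have "0 < \<epsilon> * real CARD('n)" using \<epsilon> by simp
      from exists_small_gap[OF W1 lam_pos this w]
      obtain \<mu> where \<mu>: "(\<Sum>i\<in>UNIV. ?g \<mu> i) \<le> \<epsilon> * real CARD('n)"
        unfolding \<alpha>_def by blast
      have e: "(\<lambda>z. diff w z - lam / (2 * real CARD('n)) * \<alpha> z) = (\<lambda>_. 0)"
        using lam_pos by (simp add: \<alpha>_def)
      have "primal w + ?c * dual \<mu> \<alpha> = ?c * ((\<Sum>i\<in>UNIV. ?g \<mu> i) / real CARD('n))"
        unfolding duality_gap[OF feasible_sum[OF w(1)]] e by (simp add: kernel_form_def)
      also have "\<dots> \<le> ?c * \<epsilon>"
        using \<mu> c by (intro mult_left_mono) (simp_all add: pos_divide_le_eq)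
      finally have "(dual \<mu> \<alpha> - \<epsilon>) * ?c \<le> - primal w" by (simp add: algebra_simps)
      then have "dual \<mu> \<alpha> - \<epsilon> \<le> - primal w / ?c" using c pos_le_divide_eq by blast
      then show "(INF y. dual_objective k \<rho> lam data Q y) \<le> ereal (- primal w / ?c) + ereal \<epsilon>"
        by (intro INF_lower2[of "(\<mu>, \<alpha>)"]) (simp_all add: dual_objective_eq)
    qed
  qed
  ultimately show ?thesis using lam_pos by simp
qed

section \<open>The Fenchel-Rockafellar decomposition and its conjugates\<close>

definition represents :: "('z \<Rightarrow> real) \<Rightarrow> ('z \<Rightarrow> real) \<Rightarrow> bool" where
  "represents v d \<longleftrightarrow> (\<forall>z\<in>S. v z = mean z + (\<Sum>z'\<in>S. k z z' * d z'))"

text \<open>Here \<open>v\<close> holds the values on \<open>S\<close> of the kernel mean embedding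
  of \<open>Q\<close> plus signed masses \<open>d\<close>, and \<open>\<alpha>\<close> is paired
  with these values.\<close>

lemma represents_form:
  assumes "represents v d"
  shows "(\<Sum>z\<in>S. \<alpha> z * v z) = (\<Sum>z\<in>S. \<alpha> z * mean z) + form \<alpha> d"
  using assms by (simp add: represents_def kernel_form_eq_left distrib_left sum.distrib)

text \<open>A singular Gram matrix leaves \<open>d\<close> undetermined by \<open>v\<close>, but
  pairing \<open>v\<close> with \<open>d\<close> and with \<open>d'\<close> in turn shows that the
  norm is the same. This makes the choice in \<open>discrepancy\<close> harmless.\<close>

lemma represents_unique:
  assumes "represents v d" "represents v d'"
  shows "form d d = form d' d'"
proof -
  have "form d d = form d d'"
    using represents_form[OF assms(1), of d] represents_form[OF assms(2), of d] by simp
  also have "\<dots> = form d' d" by (rule form_commute)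
  also have "\<dots> = form d' d'"
    using represents_form[OF assms(1), of d'] represents_form[OF assms(2), of d'] by simp
  finally show ?thesis .
qed

text \<open>The right-hand side exceeds the left by \<open>t * (1 - t)\<close> times the form at
  \<open>a - b\<close>.\<close>

lemma form_convex:
  assumes "0 < t" "t < 1"
  shows "form (\<lambda>z. (1 - t) * a z + t * b z) (\<lambda>z. (1 - t) * a z + t * b z)
    \<le> (1 - t) * form a a + t * form b b"
proof -
  have "0 \<le> t * (1 - t) * form (\<lambda>z. a z - b z) (\<lambda>z. a z - b z)"
    using assms form_nonneg by simp
  then show ?thesis
    unfolding kernel_form_linear by (simp add: form_commute[of b a] algebra_simps)
qed

definition weight_box :: "(real ^ 'n) set" where
  "weight_box = {w. \<forall>i. real CARD('n) * w $ i \<in> {0..W}}"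

text \<open>The function \<open>f\<close> of the decomposition. The bounds on single weights stay
  here; the constraint on the total mass goes into \<open>discrepancy\<close>.\<close>

definition regularizer :: "real ^ 'n \<Rightarrow> ereal" where
  "regularizer w
    = (if w \<in> weight_box then ereal ((\<Sum>i\<in>UNIV. r (real CARD('n) * w $ i)) / real CARD('n)) else \<infinity>)"

definition discrepancy_dom :: "(real \<times> ('z \<Rightarrow> real)) set" where
  "discrepancy_dom = {u. fst u = 1 \<and> (\<exists>d. represents (snd u) d)}"

text \<open>The function \<open>g\<close>: the normalized squared MMD, expressed through values of
  the embedding so that it depends on \<open>w\<close> only via the linear map
  \<open>moments\<close>.\<close>

definition discrepancy :: "real \<times> ('z \<Rightarrow> real) \<Rightarrow> ereal" where
  "discrepancy u = (if u \<in> discrepancy_dom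
     then let d = SOME d. represents (snd u) d in ereal (real CARD('n) / lam * form d d) else \<infinity>)"

text \<open>The linear map \<open>A\<close>: total mass, dual to \<open>\<mu>\<close>, and embedding
  values, dual to \<open>\<alpha>\<close>.\<close>

definition moments :: "real ^ 'n \<Rightarrow> real \<times> ('z \<Rightarrow> real)" where
  "moments w = (\<Sum>i\<in>UNIV. w $ i, \<lambda>z. \<Sum>i\<in>UNIV. w $ i * k z (data i))"

definition moments_adj :: "real \<times> ('z \<Rightarrow> real) \<Rightarrow> real ^ 'n" where
  "moments_adj y = (\<chi> i. fst y + (\<Sum>z\<in>S. snd y z * k z (data i)))"

lemma discrepancy_eq:
  assumes "represents v d"
  shows "discrepancy (1, v) = ereal (real CARD('n) / lam * form d d)"
proof -
  have "represents v (SOME d. represents v d)" by (rule someI[where P = "represents v", OF assms])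
  from represents_unique[OF this assms] show ?thesis
    using assms by (auto simp: discrepancy_def discrepancy_dom_def)
qed

lemma represents_diff: "represents (snd (moments w)) (diff w)"
  unfolding represents_def
proof
  fix z
  show "snd (moments w) z = mean z + (\<Sum>z'\<in>S. k z z' * diff w z')"
    using sum_diff[of w "k z"] by (simp add: moments_def mult.commute[of "k z _" "diff w _"])
qed

lemma pairing_moments: "pairing S (moments w) y = w \<bullet> moments_adj y"
proof -
  have "(\<Sum>z\<in>S. (\<Sum>i\<in>UNIV. w $ i * k z (data i)) * snd y z)
      = (\<Sum>i\<in>UNIV. w $ i * (\<Sum>z\<in>S. snd y z * k z (data i)))"
    unfolding sum_distrib_left sum_distrib_right by (subst sum.swap) (simp add: mult_ac)
  then show ?thesis
    by (simp add: pairing_def moments_def moments_adj_def inner_vec_def distrib_left sum.distrib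
        sum_distrib_right)
qed

lemma proper_convex_regularizer:
  "proper_convex (\<lambda>t x y. (1 - t) *\<^sub>R x + t *\<^sub>R y) regularizer"
proof (rule proper_convexI)
  show "regularizer w = (if w \<in> weight_box
    then ereal ((\<Sum>i\<in>UNIV. r (real CARD('n) * w $ i)) / real CARD('n)) else \<infinity>)" for w
    by (rule regularizer_def)
  have "0 \<in> weight_box" using W by (simp add: weight_box_def)
  then show "weight_box \<noteq> {}" by blast
  fix x y :: "real ^ 'n" and t :: real
  assume xy: "x \<in> weight_box" "y \<in> weight_box" and t: "0 < t" "t < 1"
  let ?v = "(1 - t) *\<^sub>R x + t *\<^sub>R y"
  have v: "real CARD('n) * ?v $ i = (1 - t) * (real CARD('n) * x $ i) + t * (real CARD('n) * y $ i)" for i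
    by (simp add: algebra_simps)
  have "(1 - t) * (real CARD('n) * x $ i) + t * (real CARD('n) * y $ i) \<in> {0..W}" for i
    using convexD_alt[of "{0..W}" "real CARD('n) * x $ i" "real CARD('n) * y $ i" t] xy t
    by (simp add: weight_box_def)
  then show "?v \<in> weight_box" unfolding weight_box_def mem_Collect_eq v by blast
  have "(\<Sum>i\<in>UNIV. r (real CARD('n) * ?v $ i))
      \<le> (\<Sum>i\<in>UNIV. (1 - t) * r (real CARD('n) * x $ i) + t * r (real CARD('n) * y $ i))"
    unfolding v using xy t by (intro sum_mono r_convex) (simp_all add: weight_box_def)
  then have "(\<Sum>i\<in>UNIV. r (real CARD('n) * ?v $ i)) / real CARD('n)
      \<le> (\<Sum>i\<in>UNIV. (1 - t) * r (real CARD('n) * x $ i) + t * r (real CARD('n) * y $ i)) / real CARD('n)"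
    by (rule divide_right_mono) simp
  then show "(\<Sum>i\<in>UNIV. r (real CARD('n) * ?v $ i)) / real CARD('n)
      \<le> (1 - t) * ((\<Sum>i\<in>UNIV. r (real CARD('n) * x $ i)) / real CARD('n))
        + t * ((\<Sum>i\<in>UNIV. r (real CARD('n) * y $ i)) / real CARD('n))"
    by (simp only: sum.distrib sum_distrib_left[symmetric] add_divide_distrib times_divide_eq_right)
qed

lemma proper_convex_discrepancy:
  assumes "0 < lam"
  shows "proper_convex comb_pair discrepancy"
proof (rule proper_convexI)
  show "discrepancy u = (if u \<in> discrepancy_dom then ereal (real_of_ereal (discrepancy u)) else \<infinity>)" for u
    by (simp add: discrepancy_def Let_def)
  \<comment> \<open>\<open>d = 0\<close> stands for \<open>Q\<close> itself.\<close>
  have "represents mean (\<lambda>_. 0)" by (simp add: represents_def)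
  then have "(1, mean) \<in> discrepancy_dom" by (auto simp: discrepancy_dom_def)
  then show "discrepancy_dom \<noteq> {}" by blast
  fix u v :: "real \<times> ('z \<Rightarrow> real)" and t :: real
  assume "u \<in> discrepancy_dom" "v \<in> discrepancy_dom" and t: "0 < t" "t < 1"
  then obtain x y a b where u: "u = (1, x)" "represents x a" and v: "v = (1, y)" "represents y b"
    by (cases u, cases v) (auto simp: discrepancy_dom_def)
  let ?d = "\<lambda>z. (1 - t) * a z + t * b z"
  have comb: "comb_pair t u v = (1, \<lambda>z. (1 - t) * x z + t * y z)"
    by (simp add: comb_pair_def u v)
  have d: "represents (\<lambda>z. (1 - t) * x z + t * y z) ?d"
    unfolding represents_def
  proof
    fix z assume "z \<in> S"
    have "(\<Sum>z'\<in>S. k z z' * ?d z')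
        = (1 - t) * (\<Sum>z'\<in>S. k z z' * a z') + t * (\<Sum>z'\<in>S. k z z' * b z')"
      unfolding sum_distrib_left sum.distrib[symmetric]
      by (intro sum.cong refl) (simp add: algebra_simps)
    moreover have "x z = mean z + (\<Sum>z'\<in>S. k z z' * a z')" "y z = mean z + (\<Sum>z'\<in>S. k z z' * b z')"
      using u(2) v(2) \<open>z \<in> S\<close> unfolding represents_def by blast+
    ultimately show "(1 - t) * x z + t * y z = mean z + (\<Sum>z'\<in>S. k z z' * ?d z')"
      by (simp only:) (simp add: algebra_simps)
  qed
  then show "comb_pair t u v \<in> discrepancy_dom" by (auto simp: comb discrepancy_dom_def)
  have "real CARD('n) / lam * form ?d ?d \<le> real CARD('n) / lam * ((1 - t) * form a a + t * form b b)"
    using assms form_convex[OF t, of a b] by (intro mult_left_mono) auto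
  also have "\<dots> = (1 - t) * (real CARD('n) / lam * form a a) + t * (real CARD('n) / lam * form b b)"
    by (simp only: distrib_left mult.left_commute)
  finally show "real_of_ereal (discrepancy (comb_pair t u v))
      \<le> (1 - t) * real_of_ereal (discrepancy u) + t * real_of_ereal (discrepancy v)"
    by (simp only: comb discrepancy_eq[OF d]) (simp add: u(1) v(1) discrepancy_eq[OF u(2)] discrepancy_eq[OF v(2)])
qed

lemma normalized_primal_eq:
  assumes "0 < lam"
  shows "normalized_primal H ip \<rho> W lam data Q w = regularizer w + discrepancy (moments w)"
proof (cases "w \<in> feasible_weights W")
  case True
  have "moments w = (1, snd (moments w))" using feasible_sum[OF True] by (simp add: moments_def)
  then have "discrepancy (moments w) = ereal (real CARD('n) / lam * form (diff w) (diff w))"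
    using discrepancy_eq[OF represents_diff[of w]] by simp
  moreover have "w \<in> weight_box" using feasible_scaled[OF True] by (simp add: weight_box_def)
  moreover have "primal w / (lam / real CARD('n)) =
      (\<Sum>i\<in>UNIV. r (real CARD('n) * w $ i)) / real CARD('n)
      + real CARD('n) / lam * form (diff w) (diff w)"
    unfolding primal_def add_divide_distrib using assms by simp
  ultimately show ?thesis
    using True assms by (simp add: normalized_primal_def primal_objective_eq regularizer_def)
next
  case False
  then have "w \<notin> weight_box \<or> (\<Sum>i\<in>UNIV. w $ i) \<noteq> 1" using feasibleI[of w] by (auto simp: weight_box_def)
  then have "regularizer w + discrepancy (moments w) = \<infinity>"
    by (auto simp: regularizer_def discrepancy_def discrepancy_dom_def moments_def)
  then show ?thesis using False by (simp add: normalized_primal_def)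
qed

text \<open>The supremum separates over the coordinates; scaling each by \<open>n\<close> turns it
  into a Legendre transform, attained at the maximizer.\<close>

lemma conjugate_regularizer:
  "conjugate (\<bullet>) regularizer v = ereal ((\<Sum>i\<in>UNIV. conj_r (v $ i)) / real CARD('n))"
proof (rule conjugate_eqI)
  have inner: "x \<bullet> v - (\<Sum>i\<in>UNIV. r (real CARD('n) * x $ i)) / real CARD('n)
      = (\<Sum>i\<in>UNIV. v $ i * (real CARD('n) * x $ i) - r (real CARD('n) * x $ i)) / real CARD('n)" for x
  proof -
    have "(\<Sum>i\<in>UNIV. v $ i * (real CARD('n) * x $ i)) = real CARD('n) * (x \<bullet> v)"
      unfolding inner_vec_def sum_distrib_left by (intro sum.cong refl) simp
    then show ?thesis by (simp add: sum_subtractf diff_divide_distrib)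
  qed
  show "ereal (x \<bullet> v) - regularizer x \<le> ereal ((\<Sum>i\<in>UNIV. conj_r (v $ i)) / real CARD('n))" for x
  proof (cases "x \<in> weight_box")
    case True
    then have "(\<Sum>i\<in>UNIV. v $ i * (real CARD('n) * x $ i) - r (real CARD('n) * x $ i))
        \<le> (\<Sum>i\<in>UNIV. conj_r (v $ i))"
      unfolding weight_box_def by (intro sum_mono young) blast
    then show ?thesis using True by (simp add: regularizer_def inner divide_right_mono)
  qed (simp add: regularizer_def)
  let ?x = "\<chi> i. maximizer (v $ i) / real CARD('n)"
  have x: "?x \<in> weight_box" using maximizer_in by (simp add: weight_box_def)
  have "ereal (?x \<bullet> v) - regularizer ?x
      = ereal (?x \<bullet> v - (\<Sum>i\<in>UNIV. r (real CARD('n) * ?x $ i)) / real CARD('n))"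
    using x by (simp add: regularizer_def)
  also have "\<dots> = ereal ((\<Sum>i\<in>UNIV. conj_r (v $ i)) / real CARD('n))"
    unfolding inner by (simp add: conj_r_def)
  finally show "ereal (?x \<bullet> v) - regularizer ?x = ereal ((\<Sum>i\<in>UNIV. conj_r (v $ i)) / real CARD('n))" .
qed

text \<open>On the domain the expression is a concave quadratic function of the representing
  \<open>d\<close>. Completing the square gives its maximum, attained at
  \<open>d = c * \<alpha>\<close>.\<close>

lemma conjugate_discrepancy:
  assumes "0 < lam"
  shows "conjugate (pairing S) discrepancy (\<mu>, \<alpha>)
    = ereal (\<mu> + lam / (4 * real CARD('n)) * form \<alpha> \<alpha> + (\<Sum>z\<in>S. \<alpha> z * mean z))"
    (is "_ = ereal ?c")
proof (rule conjugate_eqI)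
  define c where "c = lam / (2 * real CARD('n))"
  have c: "0 < c" "real CARD('n) / lam = 1 / (2 * c)" "lam / (4 * real CARD('n)) = c / 2"
    using assms by (simp_all add: c_def)
  have pair_diff: "ereal (pairing S (1, v) (\<mu>, \<alpha>)) - discrepancy (1, v)
      = ereal (\<mu> + (\<Sum>z\<in>S. \<alpha> z * mean z) + form \<alpha> d - 1 / (2 * c) * form d d)"
    if "represents v d" for v d
  proof -
    have "pairing S (1, v) (\<mu>, \<alpha>) = \<mu> + (\<Sum>z\<in>S. \<alpha> z * v z)"
      by (simp add: pairing_def mult.commute)
    then show ?thesis
      unfolding discrepancy_eq[OF that] c(2) represents_form[OF that] by (simp add: add.assoc)
  qed
  show "ereal (pairing S u (\<mu>, \<alpha>)) - discrepancy u \<le> ereal ?c" for u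
  proof (cases "u \<in> discrepancy_dom")
    case True
    then obtain v d where u: "u = (1, v)" and d: "represents v d"
      by (cases u) (auto simp: discrepancy_dom_def)
    have "0 \<le> 1 / (2 * c) * form (\<lambda>z. d z - c * \<alpha> z) (\<lambda>z. d z - c * \<alpha> z)"
      using c(1) form_nonneg by simp
    also have "\<dots> = 1 / (2 * c) * form d d - form \<alpha> d + c / 2 * form \<alpha> \<alpha>"
      unfolding kernel_form_linear
      using c(1) by (simp add: form_commute[of d \<alpha>] field_simps)
    finally show ?thesis unfolding u pair_diff[OF d] c(3) by simp
  qed (simp add: discrepancy_def)
  \<comment> \<open>This \<open>d\<close> annihilates the square; \<open>?v\<close> is built so that
    \<open>?d\<close> represents it.\<close>
  let ?d = "\<lambda>z. c * \<alpha> z"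
  let ?v = "\<lambda>z. mean z + (\<Sum>z'\<in>S. k z z' * ?d z')"
  have d: "represents ?v ?d" by (simp add: represents_def)
  show "ereal (pairing S (1, ?v) (\<mu>, \<alpha>)) - discrepancy (1, ?v) = ereal ?c"
    unfolding pair_diff[OF d] kernel_form_scale_left kernel_form_scale_right c(3)
    using c(1) by (simp add: field_simps)
qed

lemma fenchel_rockafellar:
  assumes "0 < lam"
  shows "fenchel_rockafellar_dual S
    (normalized_primal H ip \<rho> W lam data Q) (dual_objective k \<rho> lam data Q)"
proof -
  have "dual_objective k \<rho> lam data Q y
      = conjugate (\<bullet>) regularizer (- moments_adj y) + conjugate (pairing S) discrepancy y" for y
  proof -
    have "(- moments_adj y) $ i = arg (fst y) (snd y) i" for i
      by (simp add: moments_adj_def arg_eq)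
    then show ?thesis
      using dual_objective_eq[of "fst y" "snd y"] conjugate_discrepancy[OF assms, of "fst y" "snd y"]
      by (simp add: conjugate_regularizer dual_def)
  qed
  then show ?thesis
    unfolding fenchel_rockafellar_dual_def
    using proper_convex_regularizer proper_convex_discrepancy[OF assms] pairing_moments
      normalized_primal_eq[OF assms] by blast
qed

end

theorem theorem2:
  fixes Z :: "((real ^ 'dT) \<times> (real ^ 'dX)) set"
    and k :: "(real ^ 'dT) \<times> (real ^ 'dX) \<Rightarrow> (real ^ 'dT) \<times> (real ^ 'dX) \<Rightarrow> real"
    and H :: "((real ^ 'dT) \<times> (real ^ 'dX) \<Rightarrow> real) set"
    and ip :: "((real ^ 'dT) \<times> (real ^ 'dX) \<Rightarrow> real) \<Rightarrow> ((real ^ 'dT) \<times> (real ^ 'dX) \<Rightarrow> real) \<Rightarrow> real"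
    and data :: "'n::finite \<Rightarrow> (real ^ 'dT) \<times> (real ^ 'dX)"
    and Q :: "((real ^ 'dT) \<times> (real ^ 'dX)) pmf"
    and \<rho> :: "real \<Rightarrow> ereal"
    and W lam :: real
  assumes "compact Z"
    and "kernel_on Z k"
    and "continuous_on (Z \<times> Z) (\<lambda>(x, y). k x y)"
    and "is_rkhs Z k H ip"
    and "range data \<subseteq> Z"
    and "finite (set_pmf Q)" and "set_pmf Q \<subseteq> Z"
    and "0 \<le> W"
    and "\<forall>x\<in>{0..W}. \<bar>\<rho> x\<bar> \<noteq> \<infinity>" and "\<forall>x. x \<notin> {0..W} \<longrightarrow> \<rho> x = \<infinity>"
    and "strictly_convex_on {0..W} \<rho>"
    and "continuous_on {0..W} \<rho>"
    and "\<forall>x\<in>{0<..<W}. (\<lambda>y. real_of_ereal (\<rho> y)) differentiable (at x)"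
    and "0 \<le> lam"
  shows "(lam > 0 \<longrightarrow>
            fenchel_rockafellar_dual (support_points data Q)
              (normalized_primal H ip \<rho> W lam data Q) (dual_objective k \<rho> lam data Q)
            \<and> (INF w\<in>feasible_weights W. primal_objective H ip \<rho> lam data Q w)
                = ereal (- (lam / real CARD('n))) * (INF y. dual_objective k \<rho> lam data Q y))
       \<and> (\<forall>w \<mu>\<^sub>0 \<alpha>\<^sub>0.
            is_arg_min (primal_objective H ip \<rho> lam data Q) (\<lambda>w'. w' \<in> feasible_weights W) w
            \<longrightarrow> (lam = 0 \<longrightarrow> (\<forall>w'. is_arg_min (primal_objective H ip \<rho> lam data Q)
                                   (\<lambda>w'. w' \<in> feasible_weights W) w' \<longrightarrow> w' = w))
            \<longrightarrow> is_arg_min (dual_objective k \<rho> lam data Q) (\<lambda>_. True) (\<mu>\<^sub>0, \<alpha>\<^sub>0)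
            \<longrightarrow> (\<forall>i. ((\<lambda>x. real_of_ereal (legendre \<rho> x)) has_real_derivative (real CARD('n) * w $ i))
                       (at (dual_argument k data Q \<mu>\<^sub>0 \<alpha>\<^sub>0 i))))"
proof -
  interpret mmd_weighting Z k H ip data Q \<rho> W lam
    using assms by unfold_locales auto
  show ?thesis
  proof (intro conjI impI allI fenchel_rockafellar strong_duality)
    fix w \<mu>\<^sub>0 \<alpha>\<^sub>0 i
    assume w: "is_arg_min (primal_objective H ip \<rho> lam data Q) (\<lambda>w'. w' \<in> feasible_weights W) w"
      and unique: "lam = 0 \<longrightarrow> (\<forall>w'. is_arg_min (primal_objective H ip \<rho> lam data Q)
        (\<lambda>w'. w' \<in> feasible_weights W) w' \<longrightarrow> w' = w)"
      and dual_min: "is_arg_min (dual_objective k \<rho> lam data Q) (\<lambda>_. True) (\<mu>\<^sub>0, \<alpha>\<^sub>0)"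
    have arg_min_iff: "is_arg_min (primal_objective H ip \<rho> lam data Q) (\<lambda>w'. w' \<in> feasible_weights W) v
      \<longleftrightarrow> v \<in> feasible_weights W \<and> (\<forall>v'\<in>feasible_weights W. primal v \<le> primal v')" for v
      by (auto simp: is_arg_min_linorder primal_objective_eq)
    have "dual \<mu>\<^sub>0 \<alpha>\<^sub>0 \<le> dual \<mu> \<alpha>" for \<mu> \<alpha>
      using dual_min[unfolded is_arg_min_linorder, THEN conjunct2, rule_format, of "(\<mu>, \<alpha>)"]
      by (simp add: dual_objective_eq)
    then have "real CARD('n) * w $ i = maximizer (arg \<mu>\<^sub>0 \<alpha>\<^sub>0 i)"
      using w unique unfolding arg_min_iff by (intro primal_minimizer_eq) blast+
    then show "((\<lambda>x. real_of_ereal (legendre \<rho> x)) has_real_derivative (real CARD('n) * w $ i))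
        (at (dual_argument k data Q \<mu>\<^sub>0 \<alpha>\<^sub>0 i))"
      by (simp add: legendre_eq conj_deriv)
  qed
qed

end
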